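(* Let $n\ge2$, $\delta,\tau\in(0,1)$, $1\le s\le\frac{n}{n-\delta}$, and let $\Omega\subset\mathbb{R}^n$ be an $s$-distance John domain with John constant $C_J\ge1$. Then there exists a constant $C>0$ depending only on $n,s,\tau,C_J$ and $\operatorname{diam}\Omega$ such that for every $f\in L^1(\Omega)$, $$\|f-f_\Omega\|_{L^{\frac{n}{s(n-\delta)}}(\Omega)}\le C(1-\delta)\int_\Omega\int_{\{x\in\Omega:\,|x-y|<\tau d(y)\}}\frac{|f(x)-f(y)|}{|x-y|^{n+\delta}}\,dx\,dy.$$
   Context: A domain is a nonempty open connected set; $d(x)=\operatorname{dist}(x,\partial\Omega)$; $f_\Omega=\frac1{|\Omega|}\int_\Omega f\,dx$. A bounded domain $\Omega\subset\mathbb{R}^n$ is an $s$-distance John domain ($s\ge1$) with John constant $C_J\ge 1$ and John center $x_J\in\Omega$ if each $x\in\Omega$ can be joined to $x_J$ by a rectifiable curve $\gamma:[0,1]\to\Omega$, $\gamma(0)=x$, $\gamma(1)=x_J$, with $C_J\, d(\gamma(t))>|\gamma(t)-x|^s$ for all $t\in[0,1]$. *)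

theory Defs
  imports "HOL-Analysis.Analysis"
begin

definition rectifiable_path :: "(real \<Rightarrow> 'a::real_normed_vector) \<Rightarrow> bool" where
  "rectifiable_path g \<longleftrightarrow> path g \<and>
     (\<exists>L. \<forall>(m::nat) t. (\<forall>i\<le>m. t i \<in> {0..1}) \<longrightarrow> mono_on {..m} t \<longrightarrow>
        (\<Sum>i<m. dist (g (t i)) (g (t (Suc i)))) \<le> L)"

definition distance_john_domain :: "real \<Rightarrow> real \<Rightarrow> 'a::euclidean_space \<Rightarrow> 'a set \<Rightarrow> bool" where
  "distance_john_domain s CJ xJ \<Omega> \<longleftrightarrow>
     s \<ge> 1 \<and> CJ \<ge> 1 \<and> \<Omega> \<noteq> {} \<and> open \<Omega> \<and> connected \<Omega> \<and> bounded \<Omega> \<and> xJ \<in> \<Omega> \<and>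
     (\<forall>x\<in>\<Omega>. \<exists>\<gamma>. rectifiable_path \<gamma> \<and> path_image \<gamma> \<subseteq> \<Omega> \<and> pathstart \<gamma> = x \<and> pathfinish \<gamma> = xJ \<and>
        (\<forall>t\<in>{0..1}. CJ * infdist (\<gamma> t) (frontier \<Omega>) > norm (\<gamma> t - x) powr s))"

definition mean_value :: "'a::euclidean_space set \<Rightarrow> ('a \<Rightarrow> real) \<Rightarrow> real" where
  "mean_value \<Omega> f = (1 / measure lebesgue \<Omega>) * (LINT x|lebesgue_on \<Omega>. f x)"

text \<open>The $L^p$ norm for $0 < p < \infty$, with value \<open>\<infinity>\<close> for functions outside $L^p$.\<close>

definition Lp_norm :: "real \<Rightarrow> 'a::euclidean_space set \<Rightarrow> ('a \<Rightarrow> real) \<Rightarrow> ennreal" where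
  "Lp_norm p \<Omega> f =
     (let I = (\<integral>\<^sup>+x. ennreal (\<bar>f x\<bar> powr p) \<partial>lebesgue_on \<Omega>)
      in if I = \<infinity> then \<infinity> else ennreal (enn2real I powr (1 / p)))"

text \<open>On the diagonal the integrand below is \<open>0 / 0 = 0\<close>; this affects only a null set.\<close>

definition fractional_energy :: "real \<Rightarrow> real \<Rightarrow> 'a::euclidean_space set \<Rightarrow> ('a \<Rightarrow> real) \<Rightarrow> ennreal" where
  "fractional_energy \<tau> \<delta> \<Omega> f =
     (\<integral>\<^sup>+y. (\<integral>\<^sup>+x. ennreal (\<bar>f x - f y\<bar> / norm (x - y) powr (real DIM('a) + \<delta>))
           \<partial>lebesgue_on {x\<in>\<Omega>. norm (x - y) < \<tau> * infdist y (frontier \<Omega>)})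
        \<partial>lebesgue_on \<Omega>)"

end

theory Submission
  imports Defs
begin

text \<open>
  By the coarea formula, both sides reduce to indicators of superlevel sets \<open>A\<close> having density
  at most \<open>1/2\<close> in a fixed ball around the John center (the level at which the truncation starts is a
  median of \<open>f\<close> on that ball), and with \<open>p = n/(s(n-\<delta>))\<close> it suffices to bound \<open>|A|^(1/p)\<close> by the fractional perimeter of \<open>A\<close>.
  Almost every \<open>x\<close> in \<open>A\<close> is a density point, so moving first along the balls centred at \<open>x\<close> and
  then along the John curve of \<open>x\<close>, with balls of radius comparable to the distance to the boundary,
  continuity yields a ball \<open>B(z,r)\<close> in which \<open>A\<close> has density exactly \<open>1/2\<close>; the John condition gives
  \<open>|x - z| \<le> const r^(1/s)\<close>. In such a ball \<open>r^(n-\<delta>)\<close> is at most \<open>const (1-\<delta>)\<close> times the local energy.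
  Covering \<open>A\<close> by enlarged balls of radius \<open>const r^(1/s)\<close> with Vitali's lemma and summing
  \<open>r^(n/s) = (r^(n-\<delta>))^p\<close> over the disjoint balls gives the perimeter bound.

  The factor \<open>1-\<delta>\<close> arises in the half-density ball: passing through midpoints, the oscillation at scale
  \<open>2t\<close> is at most \<open>2^(n+1)\<close> times that at scale \<open>t\<close>, so each dyadic scale \<open>2^(-k) r\<close> contributes at least
  \<open>2^(-k(1-\<delta>))\<close> times the contribution of scale \<open>r\<close>, and these factors sum to about \<open>1/(1-\<delta>)\<close>.
\<close>

subsection \<open>Oscillation at dyadic scales\<close>

definition gagliardo :: "real \<Rightarrow> ('a \<times> 'a) set \<Rightarrow> ('a::euclidean_space \<Rightarrow> real) \<Rightarrow> ennreal" where
  "gagliardo \<delta> S u = (\<integral>\<^sup>+y. \<integral>\<^sup>+x. indicator S (x, y) *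
     ennreal (\<bar>u x - u y\<bar> / norm (x - y) powr (real DIM('a) + \<delta>)) \<partial>lborel \<partial>lborel)"

definition close_oscillation :: "'a set \<Rightarrow> ('a::euclidean_space \<Rightarrow> real) \<Rightarrow> real \<Rightarrow> ennreal" where
  "close_oscillation B u t = (\<integral>\<^sup>+y. \<integral>\<^sup>+x. indicator (B \<times> B) (x, y) *
     (indicator {..<t} (norm (x - y)) * ennreal \<bar>u x - u y\<bar>) \<partial>lborel \<partial>lborel)"

lemma nn_integral_lborel_midpoint:
  fixes h :: "'a::euclidean_space \<Rightarrow> ennreal"
  assumes [measurable]: "h \<in> borel_measurable borel"
  shows "(\<integral>\<^sup>+x. h (midpoint x y) \<partial>lborel) = 2 ^ DIM('a) * (\<integral>\<^sup>+m. h m \<partial>lborel)"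
proof -
  have "(\<integral>\<^sup>+x. h (midpoint x y) \<partial>lborel) =
      (\<integral>\<^sup>+x. h (midpoint x y) \<partial>density (distr lborel borel (\<lambda>m. - y + 2 *\<^sub>R m)) (\<lambda>_. ennreal (\<bar>2\<bar> ^ DIM('a))))"
    by (subst lborel_affine[of 2 "- y"]) simp_all
  also have "\<dots> = (\<integral>\<^sup>+m. 2 ^ DIM('a) * h (midpoint (- y + 2 *\<^sub>R m) y) \<partial>lborel)"
    by (simp add: nn_integral_density nn_integral_distr midpoint_def ennreal_power flip: ennreal_numeral)
  also have "\<dots> = 2 ^ DIM('a) * (\<integral>\<^sup>+m. h m \<partial>lborel)"
    by (simp add: midpoint_def nn_integral_cmult)
  finally show ?thesis .
qed

lemma close_oscillation_double:
  fixes u :: "'a::euclidean_space \<Rightarrow> real"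
  assumes B: "convex B" and [measurable]: "B \<in> sets borel" "u \<in> borel_measurable borel"
  shows "close_oscillation B u (2 * t) \<le> 2 ^ Suc DIM('a) * close_oscillation B u t"
proof -
  define k where "k x m = indicator (B \<times> B) (x, m) *
     (indicator {..<t} (norm (x - m)) * ennreal \<bar>u x - u m\<bar>)" for x m
  have [measurable]: "case_prod k \<in> borel_measurable (borel \<Otimes>\<^sub>M borel)"
    unfolding k_def[abs_def] by measurable
  have osc: "close_oscillation B u t = (\<integral>\<^sup>+y. \<integral>\<^sup>+x. k x y \<partial>lborel \<partial>lborel)"
    by (simp add: close_oscillation_def k_def)
  have le: "indicator (B \<times> B) (x, y) * (indicator {..<2 * t} (norm (x - y)) * ennreal \<bar>u x - u y\<bar>)
      \<le> k (midpoint x y) x + k (midpoint x y) y" for x y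
  proof (cases "x \<in> B \<and> y \<in> B \<and> norm (x - y) < 2 * t")
    case True
    let ?m = "midpoint x y"
    have "?m \<in> B"
      using True B convexD_alt[of B x y "1/2"] by (auto simp: midpoint_def algebra_simps)
    moreover have "norm (?m - x) < t" "norm (?m - y) < t"
      using True by (auto simp: dist_midpoint simp flip: dist_norm)
    ultimately have "k ?m x + k ?m y = ennreal (\<bar>u ?m - u x\<bar> + \<bar>u ?m - u y\<bar>)"
      using True by (auto simp: k_def)
    then show ?thesis
      using True by (auto intro!: ennreal_leI simp del: ennreal_plus)
  qed (auto simp: indicator_def)
  have "close_oscillation B u (2 * t)
      \<le> (\<integral>\<^sup>+y. \<integral>\<^sup>+x. k (midpoint x y) x + k (midpoint x y) y \<partial>lborel \<partial>lborel)"
    unfolding close_oscillation_def by (intro nn_integral_mono le)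
  also have "\<dots> = (\<integral>\<^sup>+y. \<integral>\<^sup>+x. k (midpoint x y) x \<partial>lborel \<partial>lborel)
      + (\<integral>\<^sup>+y. \<integral>\<^sup>+x. k (midpoint x y) y \<partial>lborel \<partial>lborel)"
    unfolding midpoint_def by (subst nn_integral_add[symmetric]) (simp_all add: nn_integral_add)
  also have "(\<integral>\<^sup>+y. \<integral>\<^sup>+x. k (midpoint x y) y \<partial>lborel \<partial>lborel) = 2 ^ DIM('a) * close_oscillation B u t"
    unfolding osc by (subst nn_integral_lborel_midpoint) (simp_all add: nn_integral_cmult)
  also have "(\<integral>\<^sup>+y. \<integral>\<^sup>+x. k (midpoint x y) x \<partial>lborel \<partial>lborel)
      = (\<integral>\<^sup>+x. \<integral>\<^sup>+y. k (midpoint y x) x \<partial>lborel \<partial>lborel)"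
    unfolding midpoint_def by (subst lborel_pair.Fubini') (simp_all add: add.commute)
  also have "\<dots> = 2 ^ DIM('a) * close_oscillation B u t"
    unfolding osc by (subst nn_integral_lborel_midpoint) (simp_all add: nn_integral_cmult)
  finally show ?thesis
    by (simp only: power_Suc mult_2 distrib_right)
qed

lemma sum_below_le:
  fixes b :: "nat \<Rightarrow> real"
  assumes "\<And>k. 0 \<le> b k" and "\<And>k. 2 * b k \<le> b (Suc k)" and "0 \<le> X"
  shows "(\<Sum>k<N. if b k < X then b k else 0) \<le> 2 * X"
proof -
  have "(\<Sum>k<N. if b k < X then b k else 0) \<le> min (b N) (2 * X)"
  proof (induction N)
    case (Suc N)
    then show ?case
      using assms(1)[of N] assms(2)[of N] by auto
  qed (use assms in auto)
  then show ?thesis by simp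
qed

lemma dyadic_scale_bound:
  fixes w \<rho> a :: real
  assumes "w > 0" "\<rho> > 0" "a \<ge> 1"
  shows "(\<Sum>k<N. (2 ^ k / \<rho>) powr a * indicator {..<\<rho> / 2 ^ k} w) \<le> 2 * w powr - a"
proof -
  let ?b = "\<lambda>k. (2 ^ k / \<rho>) powr a"
  have "2 * ?b k \<le> ?b (Suc k)" for k
  proof -
    have "?b (Suc k) = 2 powr a * ?b k"
      using assms by (simp add: powr_mult powr_divide)
    moreover have "2 powr 1 \<le> (2::real) powr a"
      using assms by (intro powr_mono) auto
    ultimately show ?thesis
      by (simp add: mult_right_mono)
  qed
  then have "(\<Sum>k<N. if ?b k < w powr - a then ?b k else 0) \<le> 2 * w powr - a"
    by (intro sum_below_le) auto
  moreover have "?b k * indicator {..<\<rho> / 2 ^ k} w = (if ?b k < w powr - a then ?b k else 0)" for k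
  proof -
    have "?b k < w powr - a \<longleftrightarrow> ?b k < (1 / w) powr a"
      using assms by (simp add: powr_minus_divide powr_divide)
    also have "\<dots> \<longleftrightarrow> 2 ^ k / \<rho> < 1 / w"
    proof
      show "2 ^ k / \<rho> < 1 / w" if "?b k < (1 / w) powr a"
      proof (rule ccontr)
        assume "\<not> 2 ^ k / \<rho> < 1 / w"
        then have "(1 / w) powr a \<le> ?b k"
          using assms by (intro powr_mono2) auto
        with that show False by simp
      qed
      show "?b k < (1 / w) powr a" if "2 ^ k / \<rho> < 1 / w"
        using assms that by (intro powr_less_mono2) auto
    qed
    also have "\<dots> \<longleftrightarrow> w < \<rho> / 2 ^ k"
      using assms by (auto simp: field_simps)
    finally show ?thesis by (auto simp: indicator_def)
  qed
  ultimately show ?thesis by simp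
qed

lemma close_oscillation_dyadic:
  fixes u :: "'a::euclidean_space \<Rightarrow> real"
  assumes "convex B" "B \<in> sets borel" "u \<in> borel_measurable borel"
  shows "close_oscillation B u \<rho> \<le> 2 ^ (k * Suc DIM('a)) * close_oscillation B u (\<rho> / 2 ^ k)"
proof (induction k)
  case (Suc k)
  have "2 ^ (k * Suc DIM('a)) * close_oscillation B u (2 * (\<rho> / 2 ^ Suc k))
      \<le> 2 ^ (k * Suc DIM('a)) * (2 ^ Suc DIM('a) * close_oscillation B u (\<rho> / 2 ^ Suc k))"
    by (intro mult_left_mono close_oscillation_double assms) simp
  with Suc show ?case
    by (simp add: power_add mult_ac)
qed simp

lemma geometric_sum_lower:
  fixes \<delta> :: real
  assumes "\<delta> < 1"
  obtains N :: nat where "1 \<le> 2 * ((1 - \<delta>) * (\<Sum>k<N. (2 powr - (1 - \<delta>)) ^ k))"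
proof -
  define q where "q = (2::real) powr - (1 - \<delta>)"
  have q: "0 < q" "q < 1"
    using assms by (auto simp: q_def intro: powr_less_one)
  have "exp (- (1 - \<delta>) * ln 2) \<ge> 1 + (- (1 - \<delta>) * ln 2)"
    by (rule exp_ge_add_one_self)
  moreover have "(1 - \<delta>) * ln 2 \<le> (1 - \<delta>) * 1"
    using assms ln_2_less_1 by (intro mult_left_mono) auto
  ultimately have 1: "1 - q \<le> 1 - \<delta>"
    unfolding q_def powr_def by (simp add: algebra_simps)
  obtain N where N: "q ^ N < 1 / 2"
    using real_arch_pow_inv[of "1/2" q] q by auto
  have "1 / 2 \<le> 1 - q ^ N"
    using N by simp
  also have "\<dots> = (1 - q) * (\<Sum>k<N. q ^ k)"
    by (simp add: one_diff_power_eq)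
  also have "\<dots> \<le> (1 - \<delta>) * (\<Sum>k<N. q ^ k)"
    using 1 q by (intro mult_right_mono sum_nonneg) auto
  finally show ?thesis
    using that[of N] by (simp add: q_def)
qed

lemma dyadic_scale_weight:
  fixes \<rho> \<delta> :: real
  assumes "\<rho> > 0"
  shows "\<rho> powr - (real n + \<delta>) * (2 powr - (1 - \<delta>)) ^ k = (2 ^ k / \<rho>) powr (real n + \<delta>) / 2 ^ (k * Suc n)"
proof -
  have 1: "(2 ^ k / \<rho>) powr a = 2 powr (real k * a) * \<rho> powr - a" for a
  proof -
    have "(2 ^ k / \<rho>) powr a = (2 powr real k) powr a / \<rho> powr a"
      using assms by (simp add: powr_divide powr_realpow)
    then show ?thesis
      by (simp add: powr_powr powr_minus_divide)
  qed
  have 2: "(2 powr - (1 - \<delta>)) ^ k = (2::real) powr (- (1 - \<delta>) * real k)"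
    by (subst powr_realpow[symmetric]) (auto simp: powr_powr)
  have 3: "(2::real) ^ (k * Suc n) = 2 powr (real k * (real n + 1))"
    by (subst powr_realpow[symmetric]) (simp_all add: algebra_simps)
  have "- (1 - \<delta>) * real k = real k * (real n + \<delta>) - real k * (real n + 1)"
    by (simp add: algebra_simps)
  then show ?thesis
    unfolding 1 2 3 by (simp only: powr_diff) simp
qed

lemma ennreal_divide_power2:
  assumes "0 \<le> w"
  shows "ennreal (w / 2 ^ m) * (2 ^ m * X) = ennreal w * X"
proof -
  have "ennreal w = ennreal (w / 2 ^ m) * ennreal (2 ^ m)"
    using assms by (subst ennreal_mult[symmetric]) auto
  also have "ennreal (2 ^ m) = 2 ^ m"
    by (metis ennreal_numeral ennreal_power zero_le_numeral)
  finally show ?thesis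
    by (simp add: mult.assoc)
qed

lemma close_oscillation_le_gagliardo:
  fixes u :: "'a::euclidean_space \<Rightarrow> real"
  assumes B: "convex B" and [measurable]: "B \<in> sets borel" "u \<in> borel_measurable borel"
    and \<delta>: "0 < \<delta>" "\<delta> < 1" and \<rho>: "\<rho> > 0"
  shows "ennreal (\<rho> powr - (real DIM('a) + \<delta>)) * close_oscillation B u \<rho>
      \<le> ennreal (4 * (1 - \<delta>)) * gagliardo \<delta> (B \<times> B) u"
proof -
  let ?a = "real DIM('a) + \<delta>"
  let ?w = "\<lambda>k. (2 ^ k / \<rho>) powr ?a"
  define q where "q = (2::real) powr - (1 - \<delta>)"
  obtain N where N: "1 \<le> 2 * ((1 - \<delta>) * (\<Sum>k<N. q ^ k))"
    using geometric_sum_lower[OF \<delta>(2)] unfolding q_def by metis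
  have a: "?a \<ge> 1"
    using \<delta> DIM_positive[where 'a='a] by linarith
  have scale: "\<rho> powr - ?a * q ^ k = ?w k / 2 ^ (k * Suc DIM('a))" for k
    unfolding q_def by (rule dyadic_scale_weight[OF \<rho>])
  have "ennreal (\<rho> powr - ?a * q ^ k) * close_oscillation B u \<rho>
      \<le> ennreal (?w k) * close_oscillation B u (\<rho> / 2 ^ k)" for k
  proof -
    have "ennreal (\<rho> powr - ?a * q ^ k) * close_oscillation B u \<rho>
        \<le> ennreal (?w k / 2 ^ (k * Suc DIM('a))) *
          (2 ^ (k * Suc DIM('a)) * close_oscillation B u (\<rho> / 2 ^ k))"
      unfolding scale by (intro mult_left_mono close_oscillation_dyadic B) auto
    also have "\<dots> = ennreal (?w k) * close_oscillation B u (\<rho> / 2 ^ k)"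
      by (rule ennreal_divide_power2) simp
    finally show ?thesis .
  qed
  then have "(\<Sum>k<N. ennreal (\<rho> powr - ?a * q ^ k) * close_oscillation B u \<rho>)
      \<le> (\<Sum>k<N. ennreal (?w k) * close_oscillation B u (\<rho> / 2 ^ k))"
    by (intro sum_mono)
  also have "\<dots> = (\<integral>\<^sup>+y. \<integral>\<^sup>+x. (\<Sum>k<N. ennreal (?w k) * (indicator (B \<times> B) (x, y) *
     (indicator {..<\<rho> / 2 ^ k} (norm (x - y)) * ennreal \<bar>u x - u y\<bar>))) \<partial>lborel \<partial>lborel)"
    unfolding close_oscillation_def
    by (simp add: nn_integral_sum nn_integral_cmult)
  also have "\<dots> \<le> (\<integral>\<^sup>+y. \<integral>\<^sup>+x. 2 * (indicator (B \<times> B) (x, y) *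
     ennreal (\<bar>u x - u y\<bar> / norm (x - y) powr ?a)) \<partial>lborel \<partial>lborel)"
  proof (intro nn_integral_mono)
    fix x y :: 'a
    show "(\<Sum>k<N. ennreal (?w k) * (indicator (B \<times> B) (x, y) *
       (indicator {..<\<rho> / 2 ^ k} (norm (x - y)) * ennreal \<bar>u x - u y\<bar>)))
      \<le> 2 * (indicator (B \<times> B) (x, y) * ennreal (\<bar>u x - u y\<bar> / norm (x - y) powr ?a))"
    proof (cases "(x, y) \<in> B \<times> B \<and> x \<noteq> y")
      case True
      have "(\<Sum>k<N. ennreal (?w k) * (indicator (B \<times> B) (x, y) *
          (indicator {..<\<rho> / 2 ^ k} (norm (x - y)) * ennreal \<bar>u x - u y\<bar>)))
        = ennreal ((\<Sum>k<N. ?w k * indicator {..<\<rho> / 2 ^ k} (norm (x - y))) * \<bar>u x - u y\<bar>)"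
        unfolding sum_distrib_right using True
        by (subst sum_ennreal[symmetric]) (auto intro!: sum.cong simp: indicator_def ennreal_mult)
      also have "\<dots> \<le> ennreal ((2 * norm (x - y) powr - ?a) * \<bar>u x - u y\<bar>)"
        using True \<rho> a by (intro ennreal_leI mult_right_mono dyadic_scale_bound) auto
      also have "\<dots> = 2 * (indicator (B \<times> B) (x, y) * ennreal (\<bar>u x - u y\<bar> / norm (x - y) powr ?a))"
        using True by (subst powr_minus) (simp add: ennreal_mult'' divide_inverse ac_simps)
      finally show ?thesis .
    qed (auto simp: indicator_def)
  qed
  also have "\<dots> = 2 * gagliardo \<delta> (B \<times> B) u"
    unfolding gagliardo_def by (simp add: nn_integral_cmult)
  finally have main: "ennreal (\<rho> powr - ?a * (\<Sum>k<N. q ^ k)) * close_oscillation B u \<rho>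
      \<le> 2 * gagliardo \<delta> (B \<times> B) u"
    by (simp add: q_def sum_distrib_left flip: sum_distrib_right)
  have "ennreal (\<rho> powr - ?a) * close_oscillation B u \<rho>
      \<le> ennreal (2 * (1 - \<delta>) * (\<rho> powr - ?a * (\<Sum>k<N. q ^ k))) * close_oscillation B u \<rho>"
    using mult_left_mono[OF N, of "\<rho> powr - ?a"]
    by (intro mult_right_mono ennreal_leI) (auto simp: algebra_simps)
  also have "\<dots> = ennreal (2 * (1 - \<delta>)) *
      (ennreal (\<rho> powr - ?a * (\<Sum>k<N. q ^ k)) * close_oscillation B u \<rho>)"
    using \<delta> by (subst ennreal_mult) (auto simp: q_def mult.assoc intro!: sum_nonneg mult_nonneg_nonneg)
  also have "\<dots> \<le> ennreal (2 * (1 - \<delta>)) * (2 * gagliardo \<delta> (B \<times> B) u)"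
    by (intro mult_left_mono main) simp
  also have "\<dots> = ennreal (4 * (1 - \<delta>)) * gagliardo \<delta> (B \<times> B) u"
  proof -
    have "ennreal (4 * (1 - \<delta>)) = ennreal (2 * (1 - \<delta>) * 2)"
      by (rule arg_cong[where f = ennreal]) simp
    also have "\<dots> = ennreal (2 * (1 - \<delta>)) * 2"
      using \<delta> by (subst ennreal_mult) auto
    finally show ?thesis
      by (simp add: mult.assoc)
  qed
  finally show ?thesis .
qed

subsection \<open>Half-density balls\<close>

lemma fmeasurable_Int_ball:
  fixes A :: "'a::euclidean_space set"
  assumes "A \<in> sets borel"
  shows "A \<inter> ball z r \<in> fmeasurable lborel"
  using assms emeasure_bounded_finite[of "A \<inter> ball z r"]
  by (auto simp: fmeasurable_def less_top intro: bounded_subset)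

lemma gagliardo_half_density_ball:
  fixes A :: "'a::euclidean_space set"
  assumes [measurable]: "A \<in> sets borel" and \<delta>: "0 < \<delta>" "\<delta> < 1" and r: "0 < r"
    and half: "measure lborel (A \<inter> ball z r) = measure lborel (ball z r) / 2"
  shows "ennreal (r powr (real DIM('a) - \<delta>)) \<le>
    ennreal (2 ^ (DIM('a) + 5) / (unit_ball_vol DIM('a))\<^sup>2 * (1 - \<delta>)) *
    gagliardo \<delta> (ball z r \<times> ball z r) (indicator A)"
proof -
  let ?n = "real DIM('a)" and ?B = "ball z r"
  define v where "v = unit_ball_vol ?n"
  have v: "v > 0" by (simp add: v_def)
  have vol: "measure lborel ?B = v * r ^ DIM('a)"
    using r by (simp add: v_def content_ball)
  have fm: "A \<inter> ?B \<in> fmeasurable lborel" "?B \<in> fmeasurable lborel"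
    using fmeasurable_Int_ball[of A z r] fmeasurable_Int_ball[of UNIV z r] by auto
  have inner: "emeasure lborel (A \<inter> ?B) = ennreal (v * r ^ DIM('a) / 2)"
    by (simp only: emeasure_eq_measure2[OF fm(1)] half vol)
  have "measure lborel (?B - A \<inter> ?B) = measure lborel ?B - measure lborel (A \<inter> ?B)"
    using fm by (intro measure_Diff) (auto simp: fmeasurable_def)
  then have "measure lborel (?B - A \<inter> ?B) = v * r ^ DIM('a) / 2"
    unfolding half vol by simp
  moreover have "?B - A \<inter> ?B \<in> fmeasurable lborel"
    using fm by (intro fmeasurable.Diff) auto
  ultimately have outer: "emeasure lborel (?B - A \<inter> ?B) = ennreal (v * r ^ DIM('a) / 2)"
    by (simp only: emeasure_eq_measure2)
  have "ennreal (v * r ^ DIM('a) / 2) * ennreal (v * r ^ DIM('a) / 2) =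
     (\<integral>\<^sup>+y. \<integral>\<^sup>+x. indicator (A \<inter> ?B) y * indicator (?B - A \<inter> ?B) x \<partial>lborel \<partial>lborel)"
    using assms(1)
    by (simp add: nn_integral_cmult_indicator nn_integral_multc borel_measurable_indicator outer inner)
  also have "\<dots> \<le> close_oscillation ?B (indicator A) (2 * r)"
    unfolding close_oscillation_def
  proof (intro nn_integral_mono)
    fix x y :: 'a
    have "norm (x - y) < 2 * r" if "x \<in> ?B" "y \<in> ?B"
      using that dist_triangle_less_add[of x z r y r] by (simp add: dist_norm norm_minus_commute)
    then show "indicator (A \<inter> ?B) y * indicator (?B - A \<inter> ?B) x
      \<le> indicator (?B \<times> ?B) (x, y) *
       (indicator {..<2 * r} (norm (x - y)) * ennreal \<bar>indicat_real A x - indicat_real A y\<bar>)"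
      by (auto simp: indicator_def)
  qed
  finally have osc: "ennreal (v * r ^ DIM('a) / 2) * ennreal (v * r ^ DIM('a) / 2)
      \<le> close_oscillation ?B (indicator A) (2 * r)" .
  have "r powr (?n - \<delta>) \<le> 2 powr (1 - \<delta>) * r powr (?n - \<delta>)"
    using \<delta> ge_one_powr_ge_zero[of 2 "1 - \<delta>"]
      mult_right_mono[of 1 "2 powr (1 - \<delta>)" "r powr (?n - \<delta>)"] by simp
  also have "\<dots> = 2 ^ (DIM('a) + 3) / v\<^sup>2 * ((2 * r) powr - (?n + \<delta>) * ((v * r ^ DIM('a) / 2) * (v * r ^ DIM('a) / 2)))"
  proof -
    have "2 powr (1 - \<delta>) = (2::real) ^ Suc DIM('a) * 2 powr - (?n + \<delta>)"
      by (subst powr_realpow[symmetric]) (simp_all add: powr_add[symmetric] algebra_simps flip: powr_realpow)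
    moreover have "r powr (?n - \<delta>) = r powr - (?n + \<delta>) * (r ^ DIM('a) * r ^ DIM('a))"
      using r by (simp add: powr_add[symmetric] flip: powr_realpow)
    ultimately show ?thesis
      using r v by (simp only: powr_mult) (simp add: power2_eq_square power_add field_simps)
  qed
  finally have "ennreal (r powr (?n - \<delta>)) \<le> ennreal (2 ^ (DIM('a) + 3) / v\<^sup>2) *
      (ennreal ((2 * r) powr - (?n + \<delta>)) * (ennreal (v * r ^ DIM('a) / 2) * ennreal (v * r ^ DIM('a) / 2)))"
    using r v by (simp flip: ennreal_mult)
  also have "\<dots> \<le> ennreal (2 ^ (DIM('a) + 3) / v\<^sup>2) *
      (ennreal ((2 * r) powr - (?n + \<delta>)) * close_oscillation ?B (indicator A) (2 * r))"
    by (intro mult_left_mono osc) auto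
  also have "\<dots> \<le> ennreal (2 ^ (DIM('a) + 3) / v\<^sup>2) *
      (ennreal (4 * (1 - \<delta>)) * gagliardo \<delta> (?B \<times> ?B) (indicator A))"
    using r \<delta> by (intro mult_left_mono close_oscillation_le_gagliardo) auto
  also have "\<dots> = ennreal (2 ^ (DIM('a) + 5) / v\<^sup>2 * (1 - \<delta>)) * gagliardo \<delta> (?B \<times> ?B) (indicator A)"
    using \<delta> unfolding mult.assoc[symmetric] by (subst ennreal_mult[symmetric]) (auto simp: power_add algebra_simps)
  finally show ?thesis
    by (simp add: v_def)
qed

lemma continuous_on_measure_ball:
  fixes A :: "'a::euclidean_space set"
  assumes [measurable]: "A \<in> sets borel"
  shows "continuous_on UNIV (\<lambda>(z, r). measure lborel (A \<inter> ball z r))"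
proof (subst continuous_on_sequentially, safe)
  fix w :: "nat \<Rightarrow> 'a \<times> real" and z r
  assume lim: "w \<longlonglongrightarrow> (z, r)"
  have z: "(\<lambda>k. fst (w k)) \<longlonglongrightarrow> z" and r: "(\<lambda>k. snd (w k)) \<longlonglongrightarrow> r"
    using tendsto_fst[OF lim] tendsto_snd[OF lim] by simp_all
  obtain R1 where R1: "\<And>k. dist z (fst (w k)) \<le> R1"
    using convergent_imp_bounded[OF z] unfolding bounded_any_center[of _ z] by blast
  obtain R2 where R2: "\<And>k. \<bar>snd (w k)\<bar> \<le> R2"
    using convergent_imp_bounded[OF r] unfolding bounded_iff by auto
  define B where "B k = A \<inter> ball (fst (w k)) (snd (w k))" for k
  have [measurable, simp]: "B k \<in> sets borel" for k
    by (simp add: B_def)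
  have sphere: "sphere z r \<in> null_sets lborel"
    using negligible_sphere[of z r]
    by (simp add: null_sets_completion_iff negligible_iff_null_sets)
  have "(\<lambda>k. integral\<^sup>L lborel (indicat_real (B k))) \<longlonglongrightarrow> integral\<^sup>L lborel (indicat_real (A \<inter> ball z r))"
  proof (rule integral_dominated_convergence[where w = "indicat_real (ball z (R1 + R2))"])
    show "integrable lborel (indicat_real (ball z (R1 + R2)))"
      using fmeasurable_Int_ball[of UNIV z "R1 + R2"]
      by (simp add: integrable_indicator_iff fmeasurable_def)
    show "AE x in lborel. (\<lambda>k. indicat_real (B k) x) \<longlonglongrightarrow> indicat_real (A \<inter> ball z r) x"
      using AE_not_in[OF sphere]
    proof eventually_elim
      case (elim x)
      have l1: "(\<lambda>k. snd (w k) - dist (fst (w k)) x) \<longlonglongrightarrow> r - dist z x"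
        by (intro tendsto_intros z r)
      have "eventually (\<lambda>k. x \<in> ball (fst (w k)) (snd (w k)) \<longleftrightarrow> x \<in> ball z r) sequentially"
      proof (cases "dist z x < r")
        case True
        then have "eventually (\<lambda>k. 0 < snd (w k) - dist (fst (w k)) x) sequentially"
          by (intro order_tendstoD[OF l1]) auto
        then show ?thesis by eventually_elim (use True in auto)
      next
        case False
        then have "r - dist z x < 0" using elim by auto
        then have "eventually (\<lambda>k. snd (w k) - dist (fst (w k)) x < 0) sequentially"
          by (intro order_tendstoD[OF l1]) auto
        then show ?thesis by eventually_elim (use False in auto)
      qed
      then show ?case
        by (intro tendsto_eventually) (auto simp: B_def indicator_def elim!: eventually_mono)
    qed
    show "AE x in lborel. norm (indicat_real (B k) x) \<le> indicat_real (ball z (R1 + R2)) x" for k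
    proof (intro AE_I2)
      fix x :: 'a
      have "dist z x < R1 + R2" if "dist (fst (w k)) x < snd (w k)"
        using that R1[of k] R2[of k] dist_triangle[of z x "fst (w k)"] by linarith
      then show "norm (indicat_real (B k) x) \<le> indicat_real (ball z (R1 + R2)) x"
        by (auto simp: B_def indicator_def)
    qed
  qed (simp_all add: borel_measurable_indicator)
  then show "((\<lambda>(z, r). measure lborel (A \<inter> ball z r)) \<circ> w) \<longlonglongrightarrow> measure lborel (A \<inter> ball z r)"
    by (simp add: B_def o_def case_prod_beta)
qed

lemma ball_density_gt_half:
  fixes A :: "'a::euclidean_space set"
  assumes [measurable]: "A \<in> sets borel" and "y \<in> A" "0 < \<rho>" "0 < \<delta>"
    and fin: "(\<integral>\<^sup>+x. indicator (ball y \<rho> - A) x * ennreal (1 / norm (x - y) powr (real DIM('a) + \<delta>)) \<partial>lborel) < \<infinity>"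
  obtains r where "0 < r" "r \<le> \<rho>" "measure lborel (ball y r) / 2 < measure lborel (A \<inter> ball y r)"
proof -
  let ?n = "real DIM('a)" and ?H = "\<integral>\<^sup>+x. indicator (ball y \<rho> - A) x * ennreal (1 / norm (x - y) powr (real DIM('a) + \<delta>)) \<partial>lborel"
  define H where "H = enn2real ?H"
  have H: "?H = ennreal H" "0 \<le> H"
    using fin by (auto simp: H_def)
  define v where "v = unit_ball_vol ?n"
  have v: "v > 0" by (simp add: v_def)
  define r where "r = min \<rho> ((v / (2 * (H + 1))) powr (1 / \<delta>))"
  have r: "0 < r" "r \<le> \<rho>"
    using assms v H by (auto simp: r_def)
  have "r powr \<delta> \<le> ((v / (2 * (H + 1))) powr (1 / \<delta>)) powr \<delta>"
    using assms r by (intro powr_mono2) (auto simp: r_def)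
  also have "\<dots> = v / (2 * (H + 1))"
    using assms v H by (simp add: powr_powr)
  finally have "H * r powr \<delta> \<le> H * (v / (2 * (H + 1)))"
    using H by (intro mult_left_mono) auto
  also have "\<dots> < v / 2"
    using v H by (simp add: field_simps)
  finally have small: "H * r powr \<delta> < v / 2" .
  have "ennreal (r powr - (?n + \<delta>)) * emeasure lborel (ball y r - A)
      = (\<integral>\<^sup>+x. ennreal (r powr - (?n + \<delta>)) * indicator (ball y r - A) x \<partial>lborel)"
    by (subst nn_integral_cmult_indicator) auto
  also have "\<dots> \<le> ?H"
  proof (intro nn_integral_mono)
    fix x :: 'a
    have "r powr - (?n + \<delta>) \<le> 1 / norm (x - y) powr (?n + \<delta>)" if "x \<in> ball y r - A"
    proof -
      have "0 < norm (x - y)" "norm (x - y) < r"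
        using that assms by (auto simp: dist_norm norm_minus_commute)
      then show ?thesis
        using assms r unfolding powr_minus_divide
        by (intro divide_left_mono powr_mono2 mult_pos_pos) auto
    qed
    then show "ennreal (r powr - (?n + \<delta>)) * indicator (ball y r - A) x
        \<le> indicator (ball y \<rho> - A) x * ennreal (1 / norm (x - y) powr (?n + \<delta>))"
      using r by (auto simp: indicator_def intro!: ennreal_leI)
  qed
  finally have 1: "ennreal (r powr - (?n + \<delta>)) * emeasure lborel (ball y r - A) \<le> ennreal H"
    using H by simp
  have fm: "A \<inter> ball y r \<in> fmeasurable lborel" "ball y r \<in> fmeasurable lborel"
    using fmeasurable_Int_ball[of A y r] fmeasurable_Int_ball[of UNIV y r] by auto
  have "ball y r - A \<in> fmeasurable lborel"
    using fmeasurable_Int_ball[of "- A" y r] by (simp add: Diff_eq Int_commute)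
  then have "emeasure lborel (ball y r - A) = ennreal (measure lborel (ball y r - A))"
    by (simp add: emeasure_eq_measure2)
  with 1 have "r powr - (?n + \<delta>) * measure lborel (ball y r - A) \<le> H"
    using H by (simp flip: ennreal_mult)
  then have "measure lborel (ball y r - A) \<le> H * r powr (?n + \<delta>)"
    using r unfolding powr_minus_divide by (simp add: field_simps)
  also have "\<dots> = (H * r powr \<delta>) * r ^ DIM('a)"
    using r by (simp add: powr_add powr_realpow)
  also have "\<dots> < v / 2 * r ^ DIM('a)"
    using small r by (intro mult_strict_right_mono) auto
  finally have "measure lborel (ball y r - A) < measure lborel (ball y r) / 2"
    using r by (simp add: content_ball v_def)
  moreover have "measure lborel (ball y r - A \<inter> ball y r) = measure lborel (ball y r) - measure lborel (A \<inter> ball y r)"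
    using fm by (intro measure_Diff) (auto simp: fmeasurable_def)
  moreover have "ball y r - A \<inter> ball y r = ball y r - A" by auto
  ultimately show ?thesis
    using that r by simp
qed

lemma ball_subset_infdist_frontier:
  fixes \<Omega> :: "'a::euclidean_space set"
  assumes "x \<in> \<Omega>" "r \<le> infdist x (frontier \<Omega>)"
  shows "ball x r \<subseteq> \<Omega>"
proof (rule ccontr)
  assume "\<not> ball x r \<subseteq> \<Omega>"
  moreover from this obtain w where "w \<in> ball x r" by blast
  then have "x \<in> ball x r" using zero_le_dist[of x w] by (simp del: zero_le_dist)
  ultimately have "ball x r \<inter> frontier \<Omega> \<noteq> {}"
    using assms(1) by (intro connected_Int_frontier) blast+
  then obtain w where "w \<in> frontier \<Omega>" "dist x w < r" by auto
  then show False
    using assms infdist_le[of w "frontier \<Omega>" x] by linarith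
qed

lemma infdist_frontier_pos:
  fixes \<Omega> :: "'a::euclidean_space set"
  assumes "open \<Omega>" "bounded \<Omega>" "x \<in> \<Omega>"
  shows "0 < infdist x (frontier \<Omega>)"
proof -
  have "frontier \<Omega> \<noteq> {}"
    using assms not_bounded_UNIV[where 'a='a] by (auto simp: frontier_eq_empty)
  moreover have "x \<notin> frontier \<Omega>"
    using assms by (simp add: frontier_def interior_open)
  ultimately show ?thesis
    by (intro infdist_pos_not_in_closed) auto
qed

lemma infdist_frontier_le_diameter:
  fixes \<Omega> :: "'a::euclidean_space set"
  assumes "bounded \<Omega>" "x \<in> \<Omega>"
  shows "infdist x (frontier \<Omega>) \<le> diameter \<Omega>"
proof -
  have "frontier \<Omega> \<noteq> {}"
    using assms not_bounded_UNIV[where 'a='a] by (auto simp: frontier_eq_empty)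
  then obtain w where w: "w \<in> frontier \<Omega>" by auto
  have "infdist x (frontier \<Omega>) \<le> dist x w"
    by (rule infdist_le[OF w])
  also have "\<dots> \<le> diameter (closure \<Omega>)"
    using assms w closure_subset[of \<Omega>] by (intro diameter_bounded_bound) (auto simp: frontier_def)
  finally show ?thesis
    using assms by (simp add: diameter_closure)
qed

lemma john_half_density_ball:
  fixes \<Omega> A :: "'a::euclidean_space set"
  assumes john: "distance_john_domain s CJ xJ \<Omega>" and \<kappa>: "0 < \<kappa>"
    and [measurable]: "A \<in> sets borel" and x: "x \<in> \<Omega>"
    and J: "measure lborel (A \<inter> ball xJ (\<kappa> * infdist xJ (frontier \<Omega>)))
      \<le> measure lborel (ball xJ (\<kappa> * infdist xJ (frontier \<Omega>))) / 2"
    and r0: "0 < r0" "r0 \<le> \<kappa> * infdist x (frontier \<Omega>)"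
      "measure lborel (ball x r0) / 2 < measure lborel (A \<inter> ball x r0)"
  obtains z r where "z \<in> \<Omega>" "0 < r" "r \<le> \<kappa> * infdist z (frontier \<Omega>)"
    "measure lborel (A \<inter> ball z r) = measure lborel (ball z r) / 2"
    "norm (z - x) powr s \<le> CJ * r / \<kappa>"
proof -
  let ?d = "\<lambda>z. infdist z (frontier \<Omega>)"
  define g where "g = (\<lambda>w. measure lborel (A \<inter> ball (fst w) (snd w)) - measure lborel (ball (fst w) (snd w)) / 2)"
  have cont: "continuous_on UNIV g"
    using continuous_on_measure_ball[of A] continuous_on_measure_ball[of "UNIV :: 'a set"]
    unfolding g_def by (auto intro!: continuous_intros simp: case_prod_beta)
  have cont': "continuous_on T (\<lambda>t. g (a t, b t))" if "continuous_on T a" "continuous_on T b" for T a b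
    by (rule continuous_on_compose2[OF cont]) (auto intro!: continuous_intros that)
  have op: "open \<Omega>" "bounded \<Omega>" and CJ: "CJ \<ge> 1"
    using john by (auto simp: distance_john_domain_def)
  show thesis
  proof (cases "g (x, \<kappa> * ?d x) \<le> 0")
    case True
    have "\<exists>r\<ge>r0. r \<le> \<kappa> * ?d x \<and> g (x, r) = 0"
      using True r0 by (intro IVT2' cont') (auto simp: g_def intro!: continuous_intros)
    then obtain r where r: "r \<ge> r0" "r \<le> \<kappa> * ?d x" "g (x, r) = 0" by blast
    show thesis
      using r r0 x \<kappa> CJ by (intro that[of x r]) (auto simp: g_def)
  next
    case False
    obtain \<gamma> where \<gamma>: "path \<gamma>" "path_image \<gamma> \<subseteq> \<Omega>" "\<gamma> 0 = x" "\<gamma> 1 = xJ"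
      "\<And>t. t \<in> {0..1} \<Longrightarrow> CJ * ?d (\<gamma> t) > norm (\<gamma> t - x) powr s"
      using john x unfolding distance_john_domain_def rectifiable_path_def pathstart_def pathfinish_def
      by metis
    have c\<gamma>: "continuous_on {0..1} \<gamma>"
      using \<gamma>(1) by (simp add: path_def)
    have "\<exists>t\<ge>0. t \<le> 1 \<and> g (\<gamma> t, \<kappa> * ?d (\<gamma> t)) = 0"
      using False J \<gamma> by (intro IVT2' cont' continuous_intros c\<gamma>) (auto simp: g_def)
    then obtain t where t: "t \<in> {0..1}" "g (\<gamma> t, \<kappa> * ?d (\<gamma> t)) = 0" by auto
    have in\<Omega>: "\<gamma> t \<in> \<Omega>"
      using \<gamma>(2) t by (auto simp: path_image_def)
    show thesis
      using \<kappa> t in\<Omega> \<gamma>(5)[OF t(1)] infdist_frontier_pos[OF op in\<Omega>]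
      by (intro that[of "\<gamma> t" "\<kappa> * ?d (\<gamma> t)"]) (auto simp: g_def)
  qed
qed

subsection \<open>Energies of disjoint families\<close>

definition near_pairs :: "real \<Rightarrow> 'a::euclidean_space set \<Rightarrow> ('a \<times> 'a) set" where
  "near_pairs \<tau> \<Omega> = {(x, y). x \<in> \<Omega> \<and> y \<in> \<Omega> \<and> norm (x - y) < \<tau> * infdist y (frontier \<Omega>)}"

lemma sets_near_pairs:
  assumes "open \<Omega>"
  shows "near_pairs \<tau> \<Omega> \<in> sets (borel \<Otimes>\<^sub>M borel)"
proof -
  have "near_pairs \<tau> \<Omega> = (\<Omega> \<times> \<Omega>) \<inter> {w. norm (fst w - snd w) < \<tau> * infdist (snd w) (frontier \<Omega>)}"
    by (auto simp: near_pairs_def)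
  moreover have "open \<dots>"
    using assms by (intro open_Int open_Times open_Collect_less continuous_intros) auto
  ultimately show ?thesis
    unfolding borel_prod by simp
qed

lemma gagliardo_mono:
  assumes "S \<subseteq> T"
  shows "gagliardo \<delta> S u \<le> gagliardo \<delta> T u"
  unfolding gagliardo_def using assms
  by (intro nn_integral_mono mult_right_mono) (auto simp: indicator_def)

lemma gagliardo_disjoint_union:
  fixes u :: "'a::euclidean_space \<Rightarrow> real"
  assumes C: "countable C" and [measurable]: "u \<in> borel_measurable borel"
    and S[measurable]: "\<And>i. i \<in> C \<Longrightarrow> S i \<in> sets (borel \<Otimes>\<^sub>M borel)"
    and disj: "disjoint_family_on S C" and sub: "\<And>i. i \<in> C \<Longrightarrow> S i \<subseteq> T"
  shows "(\<integral>\<^sup>+i. gagliardo \<delta> (S i) u \<partial>count_space C) \<le> gagliardo \<delta> T u"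
proof -
  let ?k = "\<lambda>x y. ennreal (\<bar>u x - u y\<bar> / norm (x - y) powr (real DIM('a) + \<delta>))"
  have "(\<integral>\<^sup>+i. gagliardo \<delta> (S i) u \<partial>count_space C)
      = (\<integral>\<^sup>+y. \<integral>\<^sup>+i. \<integral>\<^sup>+x. indicator (S i) (x, y) * ?k x y \<partial>lborel \<partial>count_space C \<partial>lborel)"
    unfolding gagliardo_def
    by (rule nn_integral_count_space_nn_integral[OF C, symmetric]) measurable
  also have "\<dots> = (\<integral>\<^sup>+y. \<integral>\<^sup>+x. \<integral>\<^sup>+i. indicator (S i) (x, y) * ?k x y \<partial>count_space C \<partial>lborel \<partial>lborel)"
    by (intro nn_integral_cong nn_integral_count_space_nn_integral[OF C, symmetric]) measurable
  also have "\<dots> \<le> gagliardo \<delta> T u"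
    unfolding gagliardo_def
  proof (intro nn_integral_mono)
    fix x y :: 'a
    show "(\<integral>\<^sup>+i. indicator (S i) (x, y) * ?k x y \<partial>count_space C) \<le> indicator T (x, y) * ?k x y"
    proof (cases "\<exists>i\<in>C. (x, y) \<in> S i")
      case True
      then obtain j where j: "j \<in> C" "(x, y) \<in> S j" by auto
      then have "(x, y) \<notin> S i" if "i \<in> C" "i \<noteq> j" for i
        using disj that by (auto simp: disjoint_family_on_def)
      then have "(\<integral>\<^sup>+i. indicator (S i) (x, y) * ?k x y \<partial>count_space C)
          = (\<integral>\<^sup>+i. ?k x y * indicator {j} i \<partial>count_space C)"
        using j by (intro nn_integral_cong) (auto simp: indicator_def)
      also have "\<dots> = ?k x y"
        using j by (subst nn_integral_cmult_indicator) (auto simp: one_ennreal_def[symmetric])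
      finally show ?thesis
        using j sub by (auto simp: indicator_def)
    next
      case False
      then have "(\<integral>\<^sup>+i. indicator (S i) (x, y) * ?k x y \<partial>count_space C) = (\<integral>\<^sup>+i. 0 \<partial>count_space C)"
        by (intro nn_integral_cong) (auto simp: indicator_def)
      then show ?thesis by simp
    qed
  qed
  finally show ?thesis .
qed

lemma emeasure_UN_le_count_space:
  assumes "countable C" and [measurable]: "\<And>i. i \<in> C \<Longrightarrow> S i \<in> sets M"
  shows "emeasure M (\<Union>i\<in>C. S i) \<le> (\<integral>\<^sup>+i. emeasure M (S i) \<partial>count_space C)"
proof -
  have "emeasure M (\<Union>i\<in>C. S i) = (\<integral>\<^sup>+x. indicator (\<Union>i\<in>C. S i) x \<partial>M)"
    using assms by (intro nn_integral_indicator[symmetric]) (auto intro!: sets.countable_UN')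
  also have "\<dots> \<le> (\<integral>\<^sup>+x. \<integral>\<^sup>+i. indicator (S i) x \<partial>count_space C \<partial>M)"
  proof (intro nn_integral_mono)
    fix x
    show "indicator (\<Union>i\<in>C. S i) x \<le> (\<integral>\<^sup>+i. indicator (S i) x \<partial>count_space C :: ennreal)"
    proof (cases "\<exists>j\<in>C. x \<in> S j")
      case True
      then obtain j where j: "j \<in> C" "x \<in> S j" by auto
      have "(1::ennreal) = (\<integral>\<^sup>+i. indicator {j} i \<partial>count_space C)"
        using j by (subst nn_integral_indicator) (auto simp: one_ennreal_def[symmetric])
      also have "\<dots> \<le> (\<integral>\<^sup>+i. indicator (S i) x \<partial>count_space C)"
        using j by (intro nn_integral_mono) (auto simp: indicator_def)
      finally show ?thesis
        using j by (auto simp: indicator_def)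
    qed (auto simp: indicator_def)
  qed
  also have "\<dots> = (\<integral>\<^sup>+i. \<integral>\<^sup>+x. indicator (S i) x \<partial>M \<partial>count_space C)"
    using assms by (intro nn_integral_count_space_nn_integral) auto
  also have "\<dots> = (\<integral>\<^sup>+i. emeasure M (S i) \<partial>count_space C)"
    by (intro nn_integral_cong) simp
  finally show ?thesis .
qed

subsection \<open>The isoperimetric inequality\<close>

lemma ennreal_mult_assoc:
  assumes "0 \<le> a" "0 \<le> b"
  shows "ennreal (a * b) * x = ennreal a * (ennreal b * x)"
  using assms by (simp add: ennreal_mult mult.assoc)

lemma john_isoperimetric_explicit:
  fixes \<Omega> A :: "'a::euclidean_space set"
  defines "n \<equiv> real DIM('a)"
  assumes \<tau>: "0 < \<tau>" "\<tau> < 1" and \<delta>: "0 < \<delta>" "\<delta> < 1" and s: "s \<le> n / (n - \<delta>)"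
    and john: "distance_john_domain s CJ xJ \<Omega>" and A[measurable]: "A \<in> sets borel"
    and J: "measure lborel (A \<inter> ball xJ (\<tau> / 3 * infdist xJ (frontier \<Omega>)))
      \<le> measure lborel (ball xJ (\<tau> / 3 * infdist xJ (frontier \<Omega>))) / 2"
  defines "p \<equiv> n / (s * (n - \<delta>))"
    and "c \<equiv> 2 ^ (DIM('a) + 5) / (unit_ball_vol n)\<^sup>2"
    and "K \<equiv> unit_ball_vol n * (5 * ((3 * CJ / \<tau>) powr (1 / s) + 1 + diameter \<Omega>)) ^ DIM('a)"
  shows "ennreal (measure lborel (A \<inter> \<Omega>) powr (1 / p))
      \<le> ennreal (max 1 K * c * (1 - \<delta>)) * gagliardo \<delta> (near_pairs \<tau> \<Omega>) (indicator A)"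
proof (cases "gagliardo \<delta> (near_pairs \<tau> \<Omega>) (indicator A) = \<infinity>")
  case True
  have "c > 0" by (auto simp: c_def n_def intro!: divide_pos_pos zero_less_power)
  then have "max 1 K * c * (1 - \<delta>) > 0"
    using \<delta> by (simp add: less_max_iff_disj)
  then have "ennreal (max 1 K * c * (1 - \<delta>)) * \<infinity> = \<infinity>"
    by (metis ennreal_eq_0_iff ennreal_mult_eq_top_iff infinity_ennreal_def not_le)
  then show ?thesis
    unfolding True by (simp only: top_greatest infinity_ennreal_def)
next
  case False
  let ?d = "\<lambda>z. infdist z (frontier \<Omega>)" and ?W = "near_pairs \<tau> \<Omega>"
  let ?G = "\<lambda>T. gagliardo \<delta> T (indicat_real A)"
  let ?k = "\<lambda>x y. ennreal (\<bar>indicat_real A x - indicat_real A y\<bar> / norm (x - y) powr (real DIM('a) + \<delta>))"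
  define \<kappa> where "\<kappa> = \<tau> / 3"
  define M where "M = (3 * CJ / \<tau>) powr (1 / s) + 1 + diameter \<Omega>"
  define X where "X = c * (1 - \<delta>) * enn2real (?G ?W)"
  have op: "open \<Omega>" "bounded \<Omega>" and CJ: "CJ \<ge> 1" and s1: "s \<ge> 1"
    using john by (auto simp: distance_john_domain_def)
  have \<kappa>: "0 < \<kappa>" "\<kappa> < 1" "\<kappa> \<le> \<tau>" using \<tau> by (auto simp: \<kappa>_def)
  have n: "n \<ge> 1" unfolding n_def by (simp add: Suc_leI)
  have n\<delta>: "n - \<delta> > 0" using n \<delta> by simp
  have p: "p \<ge> 1"
    using s s1 n n\<delta> by (simp add: p_def field_simps)
  have c: "c > 0" by (auto simp: c_def n_def intro!: divide_pos_pos zero_less_power)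
  have D: "diameter \<Omega> \<ge> 0" using op by (simp add: diameter_ge_0)
  have M: "M \<ge> 1" using D by (simp add: M_def)
  have K: "K = unit_ball_vol n * (5 * M) ^ DIM('a)" "K \<ge> 0"
    using M by (auto simp: K_def M_def n_def)
  have X: "ennreal X = ennreal (c * (1 - \<delta>)) * ?G ?W" "X \<ge> 0"
    using False c \<delta> by (auto simp: X_def ennreal_mult less_top)
  have W[measurable]: "?W \<in> sets (borel \<Otimes>\<^sub>M borel)"
    by (rule sets_near_pairs) fact
  have [measurable]: "\<Omega> \<in> sets borel" using op by simp

  define H where "H y = (\<integral>\<^sup>+x. indicator ?W (x, y) * ?k x y \<partial>lborel)" for y
  have [measurable]: "H \<in> borel_measurable borel"
    unfolding H_def by measurable
  have "AE y in lborel. H y \<noteq> \<infinity>"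
    using False by (intro nn_integral_PInf_AE) (auto simp: gagliardo_def H_def)
  then have null: "{y. H y = \<infinity>} \<in> null_sets lborel"
    by (subst (asm) AE_iff_null) auto
  define G where "G = {y \<in> A \<inter> \<Omega>. H y \<noteq> \<infinity>}"

  have "\<exists>z r. z \<in> \<Omega> \<and> 0 < r \<and> r \<le> \<kappa> * ?d z \<and>
      measure lborel (A \<inter> ball z r) = measure lborel (ball z r) / 2 \<and>
      norm (z - x) powr s \<le> CJ * r / \<kappa>" if x: "x \<in> G" for x
  proof -
    have x: "x \<in> A" "x \<in> \<Omega>" "H x < \<infinity>" using x by (auto simp: G_def less_top)
    have sub: "ball x (\<kappa> * ?d x) \<subseteq> \<Omega>"
      using x \<kappa> infdist_nonneg[of x "frontier \<Omega>"]
      by (intro ball_subset_infdist_frontier) (auto intro: mult_left_le_one_le)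
    have lt: "norm (w - x) < \<tau> * ?d x" if "w \<in> ball x (\<kappa> * ?d x)" for w
    proof -
      have "\<kappa> * ?d x \<le> \<tau> * ?d x"
        using \<kappa> by (intro mult_right_mono) (auto simp: infdist_nonneg)
      then show ?thesis using that by (simp add: dist_norm norm_minus_commute)
    qed
    have "(\<integral>\<^sup>+w. indicator (ball x (\<kappa> * ?d x) - A) w *
        ennreal (1 / norm (w - x) powr (real DIM('a) + \<delta>)) \<partial>lborel) \<le> H x"
      unfolding H_def using sub lt x
      by (intro nn_integral_mono) (auto simp: indicator_def near_pairs_def)
    also have "\<dots> < \<infinity>" by fact
    finally obtain r0 where "0 < r0" "r0 \<le> \<kappa> * ?d x"
      "measure lborel (ball x r0) / 2 < measure lborel (A \<inter> ball x r0)"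
      using ball_density_gt_half[OF A, of x "\<kappa> * ?d x" \<delta>] x \<kappa> \<delta> infdist_frontier_pos[OF op x(2)]
      by (metis mult_pos_pos)
    then show ?thesis
      using john_half_density_ball[OF john \<kappa>(1) A x(2), of r0] J unfolding \<kappa>_def by metis
  qed
  then obtain z r where zr: "\<And>x. x \<in> G \<Longrightarrow> z x \<in> \<Omega>" "\<And>x. x \<in> G \<Longrightarrow> 0 < r x"
    "\<And>x. x \<in> G \<Longrightarrow> r x \<le> \<kappa> * ?d (z x)"
    "\<And>x. x \<in> G \<Longrightarrow> measure lborel (A \<inter> ball (z x) (r x)) = measure lborel (ball (z x) (r x)) / 2"
    "\<And>x. x \<in> G \<Longrightarrow> norm (z x - x) powr s \<le> CJ * r x / \<kappa>"
    by metis
  define \<rho> where "\<rho> x = M * r x powr (1 / s)" for x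

  have rD: "r x \<le> diameter \<Omega>" if "x \<in> G" for x
  proof -
    have "r x \<le> \<kappa> * ?d (z x)" by (rule zr(3)[OF that])
    also have "\<dots> \<le> ?d (z x)"
      using \<kappa> by (intro mult_left_le_one_le) (auto simp: infdist_nonneg)
    also have "\<dots> \<le> diameter \<Omega>"
      by (rule infdist_frontier_le_diameter[OF op(2) zr(1)[OF that]])
    finally show ?thesis .
  qed
  have r\<rho>: "r x \<le> \<rho> x" if x: "x \<in> G" for x
  proof -
    have "r x = r x powr (1 / s) * r x powr (1 - 1 / s)"
      using zr(2)[OF x] by (simp flip: powr_add)
    also have "\<dots> \<le> r x powr (1 / s) * (1 + diameter \<Omega>)"
    proof (intro mult_left_mono)
      have "r x powr (1 - 1 / s) \<le> (1 + diameter \<Omega>) powr (1 - 1 / s)"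
        using rD[OF x] zr(2)[OF x] s1 by (intro powr_mono2) auto
      also have "\<dots> \<le> (1 + diameter \<Omega>) powr 1"
        using D s1 by (intro powr_mono) auto
      finally show "r x powr (1 - 1 / s) \<le> 1 + diameter \<Omega>" using D by simp
    qed simp
    also have "\<dots> \<le> \<rho> x"
      unfolding \<rho>_def by (subst mult.commute, intro mult_right_mono) (auto simp: M_def)
    finally show ?thesis .
  qed
  have "G \<subseteq> (\<Union>x\<in>G. ball (z x) (\<rho> x))"
  proof
    fix x assume x: "x \<in> G"
    have "norm (z x - x) = (norm (z x - x) powr s) powr (1 / s)"
      using s1 by (simp add: powr_powr)
    also have "\<dots> \<le> (CJ * r x / \<kappa>) powr (1 / s)"
      using zr(5)[OF x] s1 by (intro powr_mono2) auto
    also have "\<dots> = (3 * CJ / \<tau>) powr (1 / s) * r x powr (1 / s)"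
      using \<tau> CJ zr(2)[OF x] by (subst powr_mult[symmetric]) (auto simp: \<kappa>_def mult_ac)
    also have "\<dots> < \<rho> x"
      unfolding \<rho>_def using zr(2)[OF x] D by (intro mult_strict_right_mono) (auto simp: M_def)
    finally show "x \<in> (\<Union>x\<in>G. ball (z x) (\<rho> x))"
      using x by (auto simp: dist_norm)
  qed
  moreover have "0 < \<rho> x \<and> \<rho> x \<le> M * diameter \<Omega> powr (1 / s)" if x: "x \<in> G" for x
    using zr(2)[OF x] rD[OF x] M s1 unfolding \<rho>_def
    by (auto intro!: mult_left_mono powr_mono2)
  ultimately obtain C where C: "countable C" "C \<subseteq> G"
    "pairwise (\<lambda>i j. disjnt (ball (z i) (\<rho> i)) (ball (z j) (\<rho> j))) C"
    "G \<subseteq> (\<Union>i\<in>C. ball (z i) (5 * \<rho> i))"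
    by (rule Vitali_covering_lemma_balls)

  let ?S = "\<lambda>i. ball (z i) (r i) \<times> ball (z i) (r i)"
  have SW: "?S i \<subseteq> ?W" if i: "i \<in> G" for i
  proof -
    have d: "?d (z i) - r i \<le> ?d y" if "y \<in> ball (z i) (r i)" for y
      using that infdist_triangle[of "z i" "frontier \<Omega>" y] by simp
    have "ball (z i) (r i) \<subseteq> \<Omega>"
      using zr(1,3)[OF i] \<kappa> infdist_nonneg[of "z i" "frontier \<Omega>"]
      by (intro ball_subset_infdist_frontier) (auto intro: order_trans[OF _ mult_left_le_one_le])
    moreover have "norm (x - y) < \<tau> * ?d y" if "x \<in> ball (z i) (r i)" "y \<in> ball (z i) (r i)" for x y
    proof -
      have "norm (x - y) < 2 * r i"
        using that dist_triangle_less_add[of x "z i" "r i" y "r i"]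
        by (simp add: dist_norm norm_minus_commute)
      also have "2 * r i \<le> \<tau> * (?d (z i) - r i)"
      proof -
        have "(2 + \<tau>) * r i \<le> 3 * (\<tau> / 3 * ?d (z i))"
          using zr(2,3)[OF i] \<tau> by (intro mult_mono) (auto simp: \<kappa>_def)
        then show ?thesis by (simp add: algebra_simps)
      qed
      also have "\<dots> \<le> \<tau> * ?d y"
        using d[OF that(2)] \<tau> by (intro mult_left_mono) auto
      finally show ?thesis .
    qed
    ultimately show ?thesis by (auto simp: near_pairs_def)
  qed
  have disj: "disjoint_family_on ?S C"
  proof -
    have "ball (z i) (r i) \<inter> ball (z j) (r j) = {}" if "i \<in> C" "j \<in> C" "i \<noteq> j" for i j
    proof -
      have "ball (z i) (\<rho> i) \<inter> ball (z j) (\<rho> j) = {}"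
        using C(3) that by (auto simp: pairwise_def disjnt_def)
      moreover have "ball (z i) (r i) \<subseteq> ball (z i) (\<rho> i)" "ball (z j) (r j) \<subseteq> ball (z j) (\<rho> j)"
        using r\<rho> C(2) that by (auto intro!: subset_ball)
      ultimately show ?thesis by blast
    qed
    then show ?thesis by (auto simp: disjoint_family_on_def)
  qed
  have sum: "(\<integral>\<^sup>+i. ?G (?S i) \<partial>count_space C) \<le> ?G ?W"
    using C(1,2) SW disj by (intro gagliardo_disjoint_union) auto
  have ball_le: "emeasure lborel (ball (z i) (5 * \<rho> i)) \<le>
      ennreal (K * X powr (p - 1) * (c * (1 - \<delta>))) * ?G (?S i)" if i: "i \<in> C" for i
  proof -
    have iG: "i \<in> G" using i C by auto
    note ri = zr(2)[OF iG]
    define q where "q = r i powr (n - \<delta>)"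
    have q0: "q > 0" using ri by (simp add: q_def)
    have q: "ennreal q \<le> ennreal (c * (1 - \<delta>)) * ?G (?S i)"
      using gagliardo_half_density_ball[OF A \<delta> ri zr(4)[OF iG]] by (simp add: q_def c_def n_def)
    also have "\<dots> \<le> ennreal X"
      unfolding X(1) using sum C i SW[OF iG]
      by (intro mult_left_mono gagliardo_mono) auto
    finally have qX: "q \<le> X" using X(2) by simp
    have "(r i powr (1 / s)) ^ DIM('a) = r i powr (n / s)"
      using ri by (subst powr_realpow[symmetric]) (auto simp: powr_powr n_def)
    also have "n / s = (n - \<delta>) * p"
      using n\<delta> s1 by (simp add: p_def)
    also have "r i powr ((n - \<delta>) * p) = q powr (p - 1) * q"
      using q0 by (simp add: q_def powr_powr[symmetric] powr_diff)
    also have "\<dots> \<le> X powr (p - 1) * q"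
      using qX q0 p by (intro mult_right_mono powr_mono2) auto
    finally have "K * (r i powr (1 / s)) ^ DIM('a) \<le> K * (X powr (p - 1) * q)"
      using K by (intro mult_left_mono)
    then have "emeasure lborel (ball (z i) (5 * \<rho> i)) \<le> ennreal (K * (X powr (p - 1) * q))"
      using M ri by (subst emeasure_ball)
        (auto simp: \<rho>_def K(1) n_def power_mult_distrib mult_ac intro!: ennreal_leI)
    also have "\<dots> = ennreal (K * X powr (p - 1)) * ennreal q"
      using K(2) q0 unfolding mult.assoc[symmetric] by (subst ennreal_mult) auto
    also have "\<dots> \<le> ennreal (K * X powr (p - 1)) * (ennreal (c * (1 - \<delta>)) * ?G (?S i))"
      by (intro mult_left_mono q) auto
    also have "\<dots> = ennreal (K * X powr (p - 1) * (c * (1 - \<delta>))) * ?G (?S i)"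
      using K(2) c \<delta> by (subst ennreal_mult_assoc) auto
    finally show ?thesis .
  qed
  have "emeasure lborel (A \<inter> \<Omega>) \<le> emeasure lborel ({y. H y = \<infinity>} \<union> (\<Union>i\<in>C. ball (z i) (5 * \<rho> i)))"
    using C(1,4) by (intro emeasure_mono) (auto simp: G_def intro!: sets.countable_UN')
  also have "\<dots> \<le> emeasure lborel {y. H y = \<infinity>} + emeasure lborel (\<Union>i\<in>C. ball (z i) (5 * \<rho> i))"
    using C(1) by (intro emeasure_subadditive) (auto intro!: sets.countable_UN')
  also have "\<dots> = emeasure lborel (\<Union>i\<in>C. ball (z i) (5 * \<rho> i))"
    using null by auto
  also have "\<dots> \<le> (\<integral>\<^sup>+i. emeasure lborel (ball (z i) (5 * \<rho> i)) \<partial>count_space C)"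
    using C(1) by (intro emeasure_UN_le_count_space) auto
  also have "\<dots> \<le> (\<integral>\<^sup>+i. ennreal (K * X powr (p - 1) * (c * (1 - \<delta>))) * ?G (?S i) \<partial>count_space C)"
    using ball_le by (intro nn_integral_mono) auto
  also have "\<dots> = ennreal (K * X powr (p - 1) * (c * (1 - \<delta>))) * (\<integral>\<^sup>+i. ?G (?S i) \<partial>count_space C)"
    by (intro nn_integral_cmult) auto
  also have "\<dots> \<le> ennreal (K * X powr (p - 1) * (c * (1 - \<delta>))) * ?G ?W"
    by (intro mult_left_mono sum) auto
  also have "\<dots> = ennreal (K * X powr (p - 1)) * ennreal X"
    unfolding X(1) using K(2) c \<delta> by (subst ennreal_mult_assoc) auto
  also have "\<dots> = ennreal (K * X powr p)"
    using X(2) K by (cases "X = 0") (auto simp: powr_diff simp flip: ennreal_mult)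
  finally have "emeasure lborel (A \<inter> \<Omega>) \<le> ennreal (K * X powr p)" .
  then have "measure lborel (A \<inter> \<Omega>) \<le> K * X powr p"
    using K unfolding measure_def by (intro enn2real_leI) auto
  then have "measure lborel (A \<inter> \<Omega>) powr (1 / p) \<le> (max 1 K * X powr p) powr (1 / p)"
    using p mult_right_mono[of K "max 1 K" "X powr p"] by (intro powr_mono2) auto
  also have "\<dots> = max 1 K powr (1 / p) * X"
    using p X(2) by (simp add: powr_mult powr_powr)
  also have "\<dots> \<le> max 1 K powr 1 * X"
    using p X(2) by (intro mult_right_mono powr_mono) auto
  finally have "ennreal (measure lborel (A \<inter> \<Omega>) powr (1 / p)) \<le> ennreal (max 1 K * X)"
    by (intro ennreal_leI) simp
  also have "\<dots> = ennreal (max 1 K * c * (1 - \<delta>)) * ?G ?W"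
    using c \<delta> X by (simp add: ennreal_mult mult.assoc)
  finally show ?thesis .
qed

subsection \<open>Layers and medians\<close>

lemma nn_integral_Holder:
  fixes a b :: "'a \<Rightarrow> real"
  assumes [measurable]: "a \<in> borel_measurable M" "b \<in> borel_measurable M"
    and nonneg: "\<And>x. 0 \<le> a x" "\<And>x. 0 \<le> b x"
    and \<alpha>: "0 \<le> \<alpha>" "0 \<le> \<beta>" "\<alpha> + \<beta> = 1"
    and A: "(\<integral>\<^sup>+x. ennreal (a x) \<partial>M) = ennreal A" "0 \<le> A"
    and B: "(\<integral>\<^sup>+x. ennreal (b x) \<partial>M) = ennreal B" "0 \<le> B"
  shows "(\<integral>\<^sup>+x. ennreal (a x powr \<alpha> * b x powr \<beta>) \<partial>M) \<le> ennreal (A powr \<alpha> * B powr \<beta>)"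
proof (cases "A = 0 \<or> B = 0")
  case True
  then have "(AE x in M. a x = 0) \<or> (AE x in M. b x = 0)"
    using A B nonneg by (auto simp: nn_integral_0_iff_AE antisym)
  then have "AE x in M. ennreal (a x powr \<alpha> * b x powr \<beta>) = 0"
    by (auto elim: eventually_mono)
  then have "(\<integral>\<^sup>+x. ennreal (a x powr \<alpha> * b x powr \<beta>) \<partial>M) = (\<integral>\<^sup>+x. 0 \<partial>M)"
    by (rule nn_integral_cong_AE)
  then show ?thesis by simp
next
  case False
  then have pos: "A > 0" "B > 0" using A B by auto
  let ?L = "A powr \<alpha> * B powr \<beta>"
  have le: "a x powr \<alpha> * b x powr \<beta> \<le> ?L * (\<alpha> / A * a x + \<beta> / B * b x)" for x
  proof (cases "a x = 0 \<or> b x = 0")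
    case True
    then show ?thesis using nonneg[of x] \<alpha> pos by auto
  next
    case False
    then have "(a x / A) powr \<alpha> * (b x / B) powr \<beta> \<le> \<alpha> * (a x / A) + \<beta> * (b x / B)"
      using nonneg[of x] pos \<alpha> by (intro Youngs_inequality_0) (auto simp: less_le)
    then have "?L * ((a x / A) powr \<alpha> * (b x / B) powr \<beta>) \<le> ?L * (\<alpha> / A * a x + \<beta> / B * b x)"
      by (intro mult_left_mono) auto
    then show ?thesis
      using pos nonneg[of x] by (simp add: powr_divide)
  qed
  have "(\<integral>\<^sup>+x. ennreal (a x powr \<alpha> * b x powr \<beta>) \<partial>M)
      \<le> (\<integral>\<^sup>+x. ennreal ?L * (ennreal (\<alpha> / A) * ennreal (a x) + ennreal (\<beta> / B) * ennreal (b x)) \<partial>M)"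
    using le \<alpha> pos nonneg
    by (intro nn_integral_mono) (simp add: ennreal_leI flip: ennreal_mult ennreal_plus)
  also have "\<dots> = ennreal ?L * (ennreal (\<alpha> / A) * ennreal A + ennreal (\<beta> / B) * ennreal B)"
    by (simp add: nn_integral_cmult nn_integral_add A(1) B(1))
  also have "ennreal (\<alpha> / A) * ennreal A + ennreal (\<beta> / B) * ennreal B = 1"
    using pos \<alpha> by (simp flip: ennreal_mult ennreal_plus)
  finally show ?thesis by simp
qed

text \<open>
  Minkowski's integral inequality for \<open>g = \<integral> 1{g > t} dt\<close>, obtained by duality from the
  Hoelder inequality against \<open>g^(p-1)\<close>; the bound on \<open>g\<close> allows division by a power of its norm.
\<close>

lemma (in finite_measure) nn_integral_powr_le_layers_bounded:
  fixes g :: "'a \<Rightarrow> real"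
  assumes [measurable]: "g \<in> borel_measurable M" and g: "\<And>x. 0 \<le> g x" "\<And>x. g x \<le> k"
    and p: "1 \<le> p" and X: "0 \<le> X"
    and layers: "(\<integral>\<^sup>+t. indicator {0..} t * ennreal (measure M {x \<in> space M. t < g x} powr (1 / p)) \<partial>lborel)
      \<le> ennreal X"
  shows "(\<integral>\<^sup>+x. ennreal (g x powr p) \<partial>M) \<le> ennreal (X powr p)"
proof -
  interpret L: pair_sigma_finite lborel M ..
  define J where "J = enn2real (\<integral>\<^sup>+x. ennreal (g x powr p) \<partial>M)"
  have "(\<integral>\<^sup>+x. ennreal (g x powr p) \<partial>M) \<le> (\<integral>\<^sup>+x. ennreal (k powr p) \<partial>M)"
    using g p by (intro nn_integral_mono ennreal_leI powr_mono2) auto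
  also have "\<dots> < \<infinity>"
    using emeasure_finite[of "space M"] by (simp add: ennreal_mult_eq_top_iff less_top[symmetric])
  finally have J: "(\<integral>\<^sup>+x. ennreal (g x powr p) \<partial>M) = ennreal J" "0 \<le> J"
    by (auto simp: J_def)
  have holder: "(\<integral>\<^sup>+x. indicator {x \<in> space M. t < g x} x * ennreal (g x powr (p - 1)) \<partial>M)
      \<le> ennreal (measure M {x \<in> space M. t < g x} powr (1 / p) * J powr (1 - 1 / p))" for t
  proof -
    let ?E = "{x \<in> space M. t < g x}"
    have "(\<integral>\<^sup>+x. indicator ?E x * ennreal (g x powr (p - 1)) \<partial>M)
        = (\<integral>\<^sup>+x. ennreal (indicator ?E x powr (1 / p) * (g x powr p) powr (1 - 1 / p)) \<partial>M)"
      using p by (intro nn_integral_cong) (auto simp: indicator_def powr_powr algebra_simps)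
    also have "\<dots> \<le> ennreal (measure M ?E powr (1 / p) * J powr (1 - 1 / p))"
    proof (rule nn_integral_Holder[OF _ _ _ _ _ _ _ _ _ J])
      show "(\<integral>\<^sup>+x. ennreal (indicat_real ?E x) \<partial>M) = ennreal (measure M ?E)"
        by (simp add: ennreal_indicator emeasure_eq_measure)
    qed (use p in auto)
    finally show ?thesis .
  qed
  have "ennreal J = (\<integral>\<^sup>+x. \<integral>\<^sup>+t. indicator {0..<g x} t * ennreal (g x powr (p - 1)) \<partial>lborel \<partial>M)"
    unfolding J(1)[symmetric] using g
    by (intro nn_integral_cong, subst nn_integral_multc)
       (auto simp flip: ennreal_mult simp: powr_mult_base)
  also have "\<dots> = (\<integral>\<^sup>+x. \<integral>\<^sup>+t. indicator {0..} t * (indicator {x \<in> space M. t < g x} x * ennreal (g x powr (p - 1))) \<partial>lborel \<partial>M)"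
    by (intro nn_integral_cong) (auto simp: indicator_def)
  also have "\<dots> = (\<integral>\<^sup>+t. \<integral>\<^sup>+x. indicator {0..} t * (indicator {x \<in> space M. t < g x} x * ennreal (g x powr (p - 1))) \<partial>M \<partial>lborel)"
    by (rule L.Fubini') measurable
  also have "\<dots> = (\<integral>\<^sup>+t. indicator {0..} t * (\<integral>\<^sup>+x. indicator {x \<in> space M. t < g x} x * ennreal (g x powr (p - 1)) \<partial>M) \<partial>lborel)"
    by (intro nn_integral_cong nn_integral_cmult) measurable
  also have "\<dots> \<le> (\<integral>\<^sup>+t. ennreal (J powr (1 - 1 / p)) * (indicator {0..} t * ennreal (measure M {x \<in> space M. t < g x} powr (1 / p))) \<partial>lborel)"
  proof (intro nn_integral_mono)
    fix t :: real
    show "indicator {0..} t * (\<integral>\<^sup>+x. indicator {x \<in> space M. t < g x} x * ennreal (g x powr (p - 1)) \<partial>M)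
      \<le> ennreal (J powr (1 - 1 / p)) * (indicator {0..} t * ennreal (measure M {x \<in> space M. t < g x} powr (1 / p)))"
      using mult_left_mono[OF holder[of t], of "indicator {0..} t"] by (simp add: ennreal_mult mult_ac)
  qed
  also have "\<dots> = ennreal (J powr (1 - 1 / p)) * (\<integral>\<^sup>+t. indicator {0..} t * ennreal (measure M {x \<in> space M. t < g x} powr (1 / p)) \<partial>lborel)"
    by (rule nn_integral_cmult) measurable
  also have "\<dots> \<le> ennreal (J powr (1 - 1 / p)) * ennreal X"
    by (intro mult_left_mono layers) simp
  finally have le: "J \<le> J powr (1 - 1 / p) * X"
    using X by (simp flip: ennreal_mult)
  have "J \<le> X powr p"
  proof (cases "J = 0")
    case False
    then have "J powr (1 - 1 / p) * J powr (1 / p) \<le> J powr (1 - 1 / p) * X"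
      using le J by (simp flip: powr_add)
    then have "J powr (1 / p) \<le> X"
      using False by simp
    then have "(J powr (1 / p)) powr p \<le> X powr p"
      using p by (intro powr_mono2) auto
    then show ?thesis
      using p J by (simp add: powr_powr)
  qed simp
  then show ?thesis
    unfolding J(1) by (rule ennreal_leI)
qed

lemma (in finite_measure) nn_integral_powr_le_layers:
  fixes g :: "'a \<Rightarrow> real"
  assumes [measurable]: "g \<in> borel_measurable M" and g: "\<And>x. 0 \<le> g x"
    and p: "1 \<le> p" and X: "0 \<le> X"
    and layers: "(\<integral>\<^sup>+t. indicator {0..} t * ennreal (measure M {x \<in> space M. t < g x} powr (1 / p)) \<partial>lborel)
      \<le> ennreal X"
  shows "(\<integral>\<^sup>+x. ennreal (g x powr p) \<partial>M) \<le> ennreal (X powr p)"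
proof -
  have bd: "(\<integral>\<^sup>+x. ennreal (min (g x) (real k) powr p) \<partial>M) \<le> ennreal (X powr p)" for k :: nat
  proof (rule nn_integral_powr_le_layers_bounded[where k = "real k", OF _ _ _ p X])
    have "(\<integral>\<^sup>+t. indicator {0..} t * ennreal (measure M {x \<in> space M. t < min (g x) (real k)} powr (1 / p)) \<partial>lborel)
      \<le> (\<integral>\<^sup>+t. indicator {0..} t * ennreal (measure M {x \<in> space M. t < g x} powr (1 / p)) \<partial>lborel)"
      using p by (intro nn_integral_mono mult_left_mono ennreal_leI powr_mono2 finite_measure_mono) auto
    then show "(\<integral>\<^sup>+t. indicator {0..} t * ennreal (measure M {x \<in> space M. t < min (g x) (real k)} powr (1 / p)) \<partial>lborel)
      \<le> ennreal X" using layers by (rule order_trans)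
  qed (use g in auto)
  have "(\<lambda>k. \<integral>\<^sup>+x. ennreal (min (g x) (real k) powr p) \<partial>M) \<longlonglongrightarrow> (\<integral>\<^sup>+x. ennreal (g x powr p) \<partial>M)"
  proof (rule nn_integral_LIMSEQ)
    show "incseq (\<lambda>k x. ennreal (min (g x) (real k) powr p))"
      using g p by (auto simp: incseq_def le_fun_def intro!: ennreal_leI powr_mono2)
    fix x
    have "eventually (\<lambda>k. g x \<le> real k) sequentially"
      by (meson eventually_sequentiallyI order_trans of_nat_mono real_nat_ceiling_ge)
    then have "eventually (\<lambda>k. ennreal (min (g x) (real k) powr p) = ennreal (g x powr p)) sequentially"
      by eventually_elim (simp add: min_def)
    then show "(\<lambda>k. ennreal (min (g x) (real k) powr p)) \<longlonglongrightarrow> ennreal (g x powr p)"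
      by (rule tendsto_eventually)
  qed measurable
  then show ?thesis
    by (rule LIMSEQ_le_const2) (use bd in auto)
qed

lemma gagliardo_coarea:
  fixes f :: "'a::euclidean_space \<Rightarrow> real"
  assumes [measurable]: "f \<in> borel_measurable borel" "S \<in> sets (borel \<Otimes>\<^sub>M borel)"
  shows "gagliardo \<delta> S f = (\<integral>\<^sup>+t. gagliardo \<delta> S (indicator {x. t < f x}) \<partial>lborel)"
proof -
  let ?w = "\<lambda>x y. norm (x - y) powr (real DIM('a) + \<delta>)"
  let ?i = "\<lambda>t x. if t < f x then 1 else 0 :: real"
  have ind: "indicator {x. t < f x} = ?i t" for t
    by (auto simp: indicator_def)
  have pt: "ennreal (\<bar>f x - f y\<bar> / ?w x y) = (\<integral>\<^sup>+t. ennreal (\<bar>?i t x - ?i t y\<bar> / ?w x y) \<partial>lborel)" for x y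
  proof -
    have "(\<integral>\<^sup>+t. ennreal (\<bar>?i t x - ?i t y\<bar> / ?w x y) \<partial>lborel)
        = (\<integral>\<^sup>+t. ennreal (1 / ?w x y) * indicator {min (f x) (f y)..<max (f x) (f y)} t \<partial>lborel)"
      by (intro nn_integral_cong) (auto simp: indicator_def)
    also have "\<dots> = ennreal (1 / ?w x y) * ennreal (max (f x) (f y) - min (f x) (f y))"
      by (subst nn_integral_cmult_indicator) auto
    also have "\<dots> = ennreal (\<bar>f x - f y\<bar> / ?w x y)"
      by (subst ennreal_mult[symmetric]) (auto simp: max_def min_def)
    finally show ?thesis ..
  qed
  have "gagliardo \<delta> S f = (\<integral>\<^sup>+y. \<integral>\<^sup>+x. \<integral>\<^sup>+t. indicator S (x, y) * ennreal (\<bar>?i t x - ?i t y\<bar> / ?w x y) \<partial>lborel \<partial>lborel \<partial>lborel)"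
    unfolding gagliardo_def pt by (intro nn_integral_cong nn_integral_cmult[symmetric]) measurable
  also have "\<dots> = (\<integral>\<^sup>+y. \<integral>\<^sup>+t. \<integral>\<^sup>+x. indicator S (x, y) * ennreal (\<bar>?i t x - ?i t y\<bar> / ?w x y) \<partial>lborel \<partial>lborel \<partial>lborel)"
    by (intro nn_integral_cong lborel_pair.Fubini') measurable
  also have "\<dots> = (\<integral>\<^sup>+t. \<integral>\<^sup>+y. \<integral>\<^sup>+x. indicator S (x, y) * ennreal (\<bar>?i t x - ?i t y\<bar> / ?w x y) \<partial>lborel \<partial>lborel \<partial>lborel)"
    by (intro lborel_pair.Fubini') measurable
  finally show ?thesis
    unfolding gagliardo_def ind .
qed

lemma exists_median:
  fixes f :: "'a \<Rightarrow> real"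
  assumes [measurable]: "f \<in> borel_measurable M" and B: "B \<in> fmeasurable M"
  obtains m where "measure M ({x \<in> space M. m < f x} \<inter> B) \<le> measure M B / 2"
    "measure M ({x \<in> space M. f x < m} \<inter> B) \<le> measure M B / 2"
proof (cases "measure M B = 0")
  case True
  have "measure M (S \<inter> B) \<le> measure M B / 2" for S
    using True B measure_mono_fmeasurable[of "S \<inter> B" B M]
    by (cases "S \<inter> B \<in> sets M") (auto simp: measure_notin_sets)
  then show thesis by (intro that[of 0])
next
  case False
  let ?h = "measure M B / 2"
  define U where "U t = {x \<in> space M. t < f x} \<inter> B" for t
  define V where "V t = {x \<in> space M. f x \<le> t} \<inter> B" for t
  have h: "0 < ?h" using False by (simp add: less_le)
  have [measurable]: "B \<in> sets M" using B by (rule fmeasurableD)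
  have [measurable]: "U t \<in> sets M" "V t \<in> sets M" for t by (simp_all add: U_def V_def)
  have fin: "emeasure M S \<noteq> \<infinity>" if "S \<subseteq> B" for S
    using emeasure_mono[OF that, of M] B by (auto simp: fmeasurable_def less_top)
  have fm: "S \<in> fmeasurable M" if "S \<subseteq> B" "S \<in> sets M" for S
    using fin[OF that(1)] that by (auto simp: fmeasurable_def less_top)
  have fin_UV [simp]: "emeasure M (U t) \<noteq> top" "emeasure M (V t) \<noteq> top" for t
    using fin[of "U t"] fin[of "V t"] by (auto simp: U_def V_def)
  have fin_UN: "emeasure M (\<Union>k. U (g k)) \<noteq> \<infinity>" "emeasure M (\<Union>k. V (g k)) \<noteq> \<infinity>" for g :: "nat \<Rightarrow> real"
    by (intro fin; auto simp: U_def V_def)+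
  have U_anti: "U t' \<subseteq> U t" and V_mono: "V t \<subseteq> V t'" if "t \<le> t'" for t t'
    using that by (auto simp: U_def V_def)
  have BM: "B \<subseteq> space M" using sets.sets_into_space[of B M] by simp
  have UV: "measure M (U t) + measure M (V t) = measure M B" for t
  proof -
    have "B = U t \<union> V t" "U t \<inter> V t = {}" using BM by (auto simp: U_def V_def)
    then show ?thesis
      using measure_Union[of M "U t" "V t"] by simp
  qed
  have mono: "measure M (U t) \<le> measure M (U t')" if "t' \<le> t" for t t'
    using that by (intro measure_mono_fmeasurable fm) (auto simp: U_def)
  have "(\<lambda>k. measure M (U (real k))) \<longlonglongrightarrow> measure M (\<Inter>k. U (real k))"
    by (rule Lim_measure_decseq) (auto simp: decseq_def U_anti)
  moreover have "(\<Inter>k. U (real k)) = {}"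
  proof -
    have "x \<notin> (\<Inter>k. U (real k))" for x
    proof -
      obtain k where "f x \<le> real k" using real_arch_simple by blast
      then have "x \<notin> U (real k)" by (simp add: U_def)
      then show ?thesis by blast
    qed
    then show ?thesis by blast
  qed
  ultimately have "eventually (\<lambda>k. measure M (U (real k)) < ?h) sequentially"
    using h by (intro order_tendstoD) auto
  then obtain k1 where k1: "measure M (U (real k1)) < ?h"
    by (auto simp: eventually_sequentially)
  have "(\<lambda>k. measure M (V (- real k))) \<longlonglongrightarrow> measure M (\<Inter>k. V (- real k))"
    by (rule Lim_measure_decseq) (auto simp: decseq_def V_mono)
  moreover have "(\<Inter>k. V (- real k)) = {}"
  proof -
    have "x \<notin> (\<Inter>k. V (- real k))" for x
    proof -
      obtain k where "- f x < real k" using reals_Archimedean2 by blast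
      then have "x \<notin> V (- real k)" by (simp add: V_def)
      then show ?thesis by blast
    qed
    then show ?thesis by blast
  qed
  ultimately have "eventually (\<lambda>k. measure M (V (- real k)) < ?h) sequentially"
    using h by (intro order_tendstoD) auto
  then obtain k2 where k2: "measure M (V (- real k2)) < ?h"
    by (auto simp: eventually_sequentially)
  define T where "T = {t. measure M (U t) \<le> ?h}"
  define m where "m = Inf T"
  have T: "T \<noteq> {}" "bdd_below T"
  proof -
    show "T \<noteq> {}" using k1 less_imp_le unfolding T_def by blast
    have "- real k2 \<le> t" if "t \<in> T" for t
      using that k2 UV[of "- real k2"] mono[of t "- real k2"] by (force simp: T_def)
    then show "bdd_below T" by (auto simp: bdd_below_def)
  qed
  have above: "measure M (U t) \<le> ?h" if t: "m < t" for t
  proof -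
    obtain t' where "t' \<in> T" "t' < t"
      using cInf_lessD[OF T(1) t[unfolded m_def]] by blast
    then show ?thesis
      using mono[of t' t] by (auto simp: T_def)
  qed
  have below: "measure M (V t) \<le> ?h" if t: "t < m" for t
  proof -
    have "t \<notin> T" using cInf_lower[OF _ T(2), of t] t by (auto simp: m_def)
    then show ?thesis using UV[of t] by (simp add: T_def)
  qed
  have "(\<lambda>k. measure M (U (m + 1 / real (Suc k)))) \<longlonglongrightarrow> measure M (\<Union>k. U (m + 1 / real (Suc k)))"
  proof (rule Lim_measure_incseq)
    show "incseq (\<lambda>k. U (m + 1 / real (Suc k)))"
    proof (rule incseq_SucI)
      fix k
      have "1 / real (Suc (Suc k)) \<le> 1 / real (Suc k)" by (intro divide_left_mono) auto
      then show "U (m + 1 / real (Suc k)) \<subseteq> U (m + 1 / real (Suc (Suc k)))"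
        by (intro U_anti) simp
    qed
    show "range (\<lambda>k. U (m + 1 / real (Suc k))) \<subseteq> sets M"
      by auto
  qed (rule fin_UN)
  moreover have "(\<Union>k. U (m + 1 / real (Suc k))) = U m"
  proof
    show "(\<Union>k. U (m + 1 / real (Suc k))) \<subseteq> U m"
      by (intro UN_least U_anti) simp
    show "U m \<subseteq> (\<Union>k. U (m + 1 / real (Suc k)))"
    proof
      fix x assume x: "x \<in> U m"
      then have "0 < f x - m" by (simp add: U_def)
      from reals_Archimedean[OF this] obtain k where "inverse (real (Suc k)) < f x - m" ..
      then have "x \<in> U (m + 1 / real (Suc k))"
        using x by (simp add: U_def inverse_eq_divide)
      then show "x \<in> (\<Union>k. U (m + 1 / real (Suc k)))" by blast
    qed
  qed
  ultimately have "(\<lambda>k. measure M (U (m + 1 / real (Suc k)))) \<longlonglongrightarrow> measure M (U m)"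
    by (simp only:)
  then have 1: "measure M (U m) \<le> ?h"
    by (rule LIMSEQ_le_const2) (intro exI allI impI above, simp)
  have "(\<lambda>k. measure M (V (m - 1 / real (Suc k)))) \<longlonglongrightarrow> measure M (\<Union>k. V (m - 1 / real (Suc k)))"
  proof (rule Lim_measure_incseq)
    show "incseq (\<lambda>k. V (m - 1 / real (Suc k)))"
    proof (rule incseq_SucI)
      fix k
      have "1 / real (Suc (Suc k)) \<le> 1 / real (Suc k)" by (intro divide_left_mono) auto
      then show "V (m - 1 / real (Suc k)) \<subseteq> V (m - 1 / real (Suc (Suc k)))"
        by (intro V_mono) simp
    qed
    show "range (\<lambda>k. V (m - 1 / real (Suc k))) \<subseteq> sets M"
      by auto
  qed (rule fin_UN)
  moreover have "(\<Union>k. V (m - 1 / real (Suc k))) = {x \<in> space M. f x < m} \<inter> B"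
  proof
    show "(\<Union>k. V (m - 1 / real (Suc k))) \<subseteq> {x \<in> space M. f x < m} \<inter> B"
    proof
      fix x assume "x \<in> (\<Union>k. V (m - 1 / real (Suc k)))"
      then obtain k where "x \<in> V (m - 1 / real (Suc k))" by blast
      moreover have "m - 1 / real (Suc k) < m" by simp
      ultimately show "x \<in> {x \<in> space M. f x < m} \<inter> B"
        unfolding V_def by (blast intro: le_less_trans)
    qed
    show "{x \<in> space M. f x < m} \<inter> B \<subseteq> (\<Union>k. V (m - 1 / real (Suc k)))"
    proof
      fix x assume x: "x \<in> {x \<in> space M. f x < m} \<inter> B"
      then have "0 < m - f x" by simp
      from reals_Archimedean[OF this] obtain k where "inverse (real (Suc k)) < m - f x" ..
      then have "x \<in> V (m - 1 / real (Suc k))"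
        using x by (simp add: V_def inverse_eq_divide)
      then show "x \<in> (\<Union>k. V (m - 1 / real (Suc k)))" by blast
    qed
  qed
  ultimately have "(\<lambda>k. measure M (V (m - 1 / real (Suc k)))) \<longlonglongrightarrow> measure M ({x \<in> space M. f x < m} \<inter> B)"
    by (simp only:)
  then have 2: "measure M ({x \<in> space M. f x < m} \<inter> B) \<le> ?h"
    by (rule LIMSEQ_le_const2) (intro exI allI impI below, simp)
  show thesis
    using 1 2 by (intro that[of m]) (auto simp: U_def)
qed

subsection \<open>From sets to functions\<close>

lemma lborel_fractional_energy:
  fixes \<Omega> :: "'a::euclidean_space set"
  assumes "open \<Omega>" and ae: "AE x in lborel. x \<in> \<Omega> \<longrightarrow> f x = f' x"
  shows "fractional_energy \<tau> \<delta> \<Omega> f = gagliardo \<delta> (near_pairs \<tau> \<Omega>) f'"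
proof -
  let ?k = "\<lambda>f x y. ennreal (\<bar>f x - f y\<bar> / norm (x - y) powr (real DIM('a) + \<delta>))"
  let ?S = "\<lambda>y. {x \<in> \<Omega>. norm (x - y) < \<tau> * infdist y (frontier \<Omega>)}"
  have "open (?S y)" for y
    using assms(1) by (intro open_Collect_conj open_Collect_less continuous_intros) (simp add: Collect_mem_eq)
  then have S: "?S y \<in> sets lebesgue" for y by simp
  have "fractional_energy \<tau> \<delta> \<Omega> f
      = (\<integral>\<^sup>+y. (\<integral>\<^sup>+x. ?k f x y * indicator (?S y) x \<partial>lborel) * indicator \<Omega> y \<partial>lborel)"
    unfolding fractional_energy_def using S assms(1)
    by (simp add: nn_integral_restrict_space nn_integral_completion)
  also have "\<dots> = (\<integral>\<^sup>+y. \<integral>\<^sup>+x. indicator (near_pairs \<tau> \<Omega>) (x, y) * ?k f' x y \<partial>lborel \<partial>lborel)"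
  proof (rule nn_integral_cong_AE)
    show "AE y in lborel. (\<integral>\<^sup>+x. ?k f x y * indicator (?S y) x \<partial>lborel) * indicator \<Omega> y
        = (\<integral>\<^sup>+x. indicator (near_pairs \<tau> \<Omega>) (x, y) * ?k f' x y \<partial>lborel)"
      using ae
    proof eventually_elim
      case (elim y)
      show ?case
      proof (cases "y \<in> \<Omega>")
        case True
        have "(\<integral>\<^sup>+x. ?k f x y * indicator (?S y) x \<partial>lborel)
          = (\<integral>\<^sup>+x. indicator (near_pairs \<tau> \<Omega>) (x, y) * ?k f' x y \<partial>lborel)"
          by (rule nn_integral_cong_AE, use ae in eventually_elim)
             (use elim True in \<open>auto simp: near_pairs_def indicator_def\<close>)
        then show ?thesis using True by simp
      qed (simp add: near_pairs_def)
    qed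
  qed
  finally show ?thesis unfolding gagliardo_def .
qed

lemma john_truncated_Lp_bound:
  fixes \<Omega> :: "'a::euclidean_space set"
  assumes op: "open \<Omega>" "bounded \<Omega>" and [measurable]: "f \<in> borel_measurable borel" and p: "1 \<le> p"
    and c: "0 \<le> c" and X: "ennreal c * gagliardo \<delta> (near_pairs \<tau> \<Omega>) f \<le> ennreal X" "0 \<le> X"
    and iso: "\<And>A. A \<in> sets borel \<Longrightarrow> measure lborel (A \<inter> B) \<le> measure lborel B / 2 \<Longrightarrow>
      ennreal (measure lborel (A \<inter> \<Omega>) powr (1 / p)) \<le> ennreal c * gagliardo \<delta> (near_pairs \<tau> \<Omega>) (indicator A)"
    and B: "B \<in> fmeasurable lborel" and m: "measure lborel ({x. m < f x} \<inter> B) \<le> measure lborel B / 2"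
  shows "(\<integral>\<^sup>+x. ennreal (max 0 (f x - m) powr p) \<partial>restrict_space lborel \<Omega>) \<le> ennreal (X powr p)"
proof -
  let ?G = "gagliardo \<delta> (near_pairs \<tau> \<Omega>)" and ?M = "restrict_space lborel \<Omega>"
  have [measurable]: "\<Omega> \<in> sets borel" using op by simp
  have W[measurable]: "near_pairs \<tau> \<Omega> \<in> sets (borel \<Otimes>\<^sub>M borel)" using op(1) by (rule sets_near_pairs)
  have "emeasure lborel \<Omega> < \<infinity>" using op(2) by (rule emeasure_bounded_finite)
  then interpret finite_measure ?M
    by (intro finite_measureI) (simp add: emeasure_restrict_space less_top)
  have [measurable]: "f \<in> borel_measurable ?M" by (rule measurable_restrict_space1) simp
  have layer: "indicator {0..} t * ennreal (measure ?M {x \<in> space ?M. t < max 0 (f x - m)} powr (1 / p))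
      \<le> ennreal c * ?G (indicator {x. m + t < f x})" for t :: real
  proof (cases "0 \<le> t")
    case True
    have "measure lborel ({x. m + t < f x} \<inter> B) \<le> measure lborel ({x. m < f x} \<inter> B)"
    proof (rule measure_mono_fmeasurable)
      show "{x. m < f x} \<inter> B \<in> fmeasurable lborel"
        by (rule fmeasurableI2[OF B]) (use B in auto)
    qed (use True B in auto)
    then have "ennreal (measure lborel ({x. m + t < f x} \<inter> \<Omega>) powr (1 / p))
        \<le> ennreal c * ?G (indicator {x. m + t < f x})"
      using m by (intro iso) auto
    moreover have "{x \<in> space ?M. t < max 0 (f x - m)} = {x. m + t < f x} \<inter> \<Omega>"
      using True by (auto simp: space_restrict_space)
    ultimately show ?thesis
      using True by (simp add: measure_restrict_space)
  qed simp
  show ?thesis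
  proof (rule nn_integral_powr_le_layers[OF _ _ p X(2)])
    have "(\<integral>\<^sup>+t. indicator {0..} t * ennreal (measure ?M {x \<in> space ?M. t < max 0 (f x - m)} powr (1 / p)) \<partial>lborel)
      \<le> (\<integral>\<^sup>+t. ennreal c * ?G (indicator {x. m + t < f x}) \<partial>lborel)"
      by (intro nn_integral_mono layer)
    also have "\<dots> = ennreal c * (\<integral>\<^sup>+t. ?G (indicator {x. m + t < f x}) \<partial>lborel)"
    proof (rule nn_integral_cmult)
      have ind: "indicator {x. m + t < f x} = (\<lambda>x. if m + t < f x then 1 else 0 :: real)" for t
        by (auto simp: indicator_def)
      show "(\<lambda>t. ?G (indicator {x. m + t < f x})) \<in> borel_measurable lborel"
        unfolding gagliardo_def ind by measurable
    qed
    also have "(\<integral>\<^sup>+t. ?G (indicator {x. m + t < f x}) \<partial>lborel) = (\<integral>\<^sup>+t. ?G (indicator {x. t < f x}) \<partial>lborel)"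
    proof -
      have ind: "indicator {x. t < f x} = (\<lambda>x. if t < f x then 1 else 0 :: real)" for t
        by (auto simp: indicator_def)
      have "(\<lambda>t. ?G (indicator {x. t < f x})) \<in> borel_measurable borel"
        unfolding gagliardo_def ind by measurable
      from nn_integral_real_affine[OF this, of 1 m] show ?thesis by simp
    qed
    also have "\<dots> = ?G f"
      by (rule gagliardo_coarea[symmetric]) measurable
    finally show "(\<integral>\<^sup>+t. indicator {0..} t * ennreal (measure ?M {x \<in> space ?M. t < max 0 (f x - m)} powr (1 / p)) \<partial>lborel)
      \<le> ennreal X"
      using X(1) by (rule order_trans)
  qed auto
qed

lemma nn_integral_powr_mean_le:
  fixes h :: "'a \<Rightarrow> real"
  assumes M: "finite_measure M" and h: "integrable M h" and p: "1 \<le> p"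
    and J: "(\<integral>\<^sup>+x. ennreal (\<bar>h x\<bar> powr p) \<partial>M) \<le> ennreal J" "0 \<le> J"
    and V: "0 < measure M (space M)"
  shows "measure M (space M) * \<bar>(LINT x|M. h x) / measure M (space M)\<bar> powr p \<le> J"
proof -
  interpret finite_measure M by fact
  let ?V = "measure M (space M)"
  have [measurable]: "h \<in> borel_measurable M" using h by simp
  obtain J' where J': "(\<integral>\<^sup>+x. ennreal (\<bar>h x\<bar> powr p) \<partial>M) = ennreal J'" "0 \<le> J'" "J' \<le> J"
    using J by (cases "\<integral>\<^sup>+x. ennreal (\<bar>h x\<bar> powr p) \<partial>M") (auto simp: top_unique)
  have "ennreal \<bar>LINT x|M. h x\<bar> \<le> ennreal (LINT x|M. \<bar>h x\<bar>)"
    by (intro ennreal_leI) (rule integral_abs_bound)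
  also have "\<dots> = (\<integral>\<^sup>+x. ennreal \<bar>h x\<bar> \<partial>M)"
    using h by (intro nn_integral_eq_integral[symmetric]) auto
  also have "\<dots> = (\<integral>\<^sup>+x. ennreal ((\<bar>h x\<bar> powr p) powr (1 / p) * 1 powr (1 - 1 / p)) \<partial>M)"
    using p by (simp add: powr_powr)
  also have "\<dots> \<le> ennreal (J' powr (1 / p) * ?V powr (1 - 1 / p))"
    using p J' by (intro nn_integral_Holder) (auto simp: emeasure_eq_measure)
  finally have "\<bar>LINT x|M. h x\<bar> \<le> J' powr (1 / p) * ?V powr (1 - 1 / p)"
    by simp
  then have "\<bar>LINT x|M. h x\<bar> powr p \<le> (J' powr (1 / p) * ?V powr (1 - 1 / p)) powr p"
    using p by (intro powr_mono2) auto
  also have "\<dots> = J' * ?V powr (p - 1)"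
    using p J' V by (simp add: powr_mult powr_powr algebra_simps)
  also have "\<dots> \<le> J * ?V powr (p - 1)"
    using J' by (intro mult_right_mono) auto
  finally have "?V * (\<bar>LINT x|M. h x\<bar> powr p / ?V powr p) \<le> J"
    using V by (simp add: powr_diff field_simps)
  then show ?thesis
    using V by (simp add: abs_divide powr_divide)
qed

lemma powr_add_le:
  fixes a b :: real
  assumes "0 \<le> a" "0 \<le> b" "0 \<le> p"
  shows "(a + b) powr p \<le> 2 powr p * (a powr p + b powr p)"
proof -
  have "(a + b) powr p \<le> (2 * max a b) powr p"
    using assms by (intro powr_mono2) auto
  also have "\<dots> = 2 powr p * max a b powr p"
    using assms by (simp add: powr_mult)
  also have "\<dots> \<le> 2 powr p * (a powr p + b powr p)"
    by (intro mult_left_mono) (auto simp: max_def)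
  finally show ?thesis .
qed

lemma Lp_norm_le:
  assumes "(\<integral>\<^sup>+x. ennreal (\<bar>f x\<bar> powr p) \<partial>lebesgue_on \<Omega>) \<le> ennreal (Y powr p)" "0 \<le> Y" "0 < p"
  shows "Lp_norm p \<Omega> f \<le> ennreal Y"
proof -
  define I where "I = (\<integral>\<^sup>+x. ennreal (\<bar>f x\<bar> powr p) \<partial>lebesgue_on \<Omega>)"
  have I: "I \<le> ennreal (Y powr p)" using assms(1) by (simp add: I_def)
  then have "I \<noteq> \<infinity>" by (auto simp: top_unique)
  moreover have "enn2real I \<le> Y powr p"
    using I by (intro enn2real_leI) auto
  then have "enn2real I powr (1 / p) \<le> (Y powr p) powr (1 / p)"
    using assms by (intro powr_mono2) auto
  ultimately show ?thesis
    using assms by (simp add: Lp_norm_def I_def[symmetric] powr_powr ennreal_leI)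
qed

lemma john_fractional_sobolev_poincare:
  fixes \<Omega> :: "'a::euclidean_space set"
  assumes \<tau>: "0 < \<tau>" "\<tau> < 1" and \<delta>: "0 < \<delta>" "\<delta> < 1"
    and s: "s \<le> real DIM('a) / (real DIM('a) - \<delta>)" and john: "distance_john_domain s CJ xJ \<Omega>"
    and f: "integrable (lebesgue_on \<Omega>) f"
  defines "p \<equiv> real DIM('a) / (s * (real DIM('a) - \<delta>))"
    and "C \<equiv> max 1 (unit_ball_vol DIM('a) * (5 * ((3 * CJ / \<tau>) powr (1 / s) + 1 + diameter \<Omega>)) ^ DIM('a)) *
        (2 ^ (DIM('a) + 5) / (unit_ball_vol DIM('a))\<^sup>2)"
  shows "Lp_norm p \<Omega> (\<lambda>x. f x - mean_value \<Omega> f)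
    \<le> ennreal (8 * C * (1 - \<delta>)) * fractional_energy \<tau> \<delta> \<Omega> f"
proof (cases "fractional_energy \<tau> \<delta> \<Omega> f = \<infinity>")
  case True
  have "C > 0"
    unfolding C_def by (intro mult_pos_pos divide_pos_pos zero_less_power) (auto simp: less_max_iff_disj)
  then have "8 * C * (1 - \<delta>) > 0" using \<delta> by simp
  then have "ennreal (8 * C * (1 - \<delta>)) * \<infinity> = \<infinity>"
    by (metis ennreal_eq_0_iff ennreal_mult_eq_top_iff infinity_ennreal_def not_le)
  then show ?thesis
    unfolding True by (simp only: top_greatest infinity_ennreal_def)
next
  case False
  let ?n = "real DIM('a)"
  have op: "open \<Omega>" "bounded \<Omega>" and s1: "s \<ge> 1" and ne: "\<Omega> \<noteq> {}" and xJ: "xJ \<in> \<Omega>"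
    using john by (auto simp: distance_john_domain_def)
  have n: "?n \<ge> 1" by (simp add: Suc_leI)
  have p: "p \<ge> 1"
  proof -
    have "?n - \<delta> > 0" using n \<delta> by linarith
    then show ?thesis
      using s s1 by (simp add: p_def pos_le_divide_eq)
  qed
  have C: "C > 0"
    unfolding C_def by (intro mult_pos_pos divide_pos_pos zero_less_power) (auto simp: less_max_iff_disj)
  define c where "c = C * (1 - \<delta>)"
  have c: "c > 0" using C \<delta> by (simp add: c_def)
  define X where "X = c * enn2real (fractional_energy \<tau> \<delta> \<Omega> f)"
  have X: "ennreal X = ennreal c * fractional_energy \<tau> \<delta> \<Omega> f" "0 \<le> X"
    using False c by (auto simp: X_def ennreal_mult less_top)
  have [measurable]: "\<Omega> \<in> sets borel" using op by simp

  have "(\<lambda>x. if x \<in> \<Omega> then f x else 0) \<in> borel_measurable lebesgue"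
    using f op by (subst borel_measurable_if) auto
  from completion_ex_borel_measurable_real[OF this] obtain f' where
    f'[measurable]: "f' \<in> borel_measurable borel" and "AE x in lborel. (if x \<in> \<Omega> then f x else 0) = f' x"
    by auto
  then have ae: "AE x in lborel. x \<in> \<Omega> \<longrightarrow> f x = f' x"
    by (auto elim: eventually_mono split: if_splits)
  have energy: "gagliardo \<delta> (near_pairs \<tau> \<Omega>) f' = fractional_energy \<tau> \<delta> \<Omega> f"
    using lborel_fractional_energy[OF op(1) ae] by simp
  have energy_neg: "gagliardo \<delta> (near_pairs \<tau> \<Omega>) (\<lambda>x. - f' x) = fractional_energy \<tau> \<delta> \<Omega> f"
    unfolding energy[symmetric] gagliardo_def by (simp add: abs_minus_commute)
  define B where "B = ball xJ (\<tau> / 3 * infdist xJ (frontier \<Omega>))"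
  have B: "B \<in> fmeasurable lborel"
    using fmeasurable_Int_ball[of UNIV] by (simp add: B_def)
  have iso: "ennreal (measure lborel (A \<inter> \<Omega>) powr (1 / p)) \<le> ennreal c * gagliardo \<delta> (near_pairs \<tau> \<Omega>) (indicator A)"
    if "A \<in> sets borel" "measure lborel (A \<inter> B) \<le> measure lborel B / 2" for A
    using john_isoperimetric_explicit[OF \<tau> \<delta> s john that(1)] that(2)
    unfolding B_def c_def C_def p_def .
  obtain m where m: "measure lborel ({x \<in> space lborel. m < f' x} \<inter> B) \<le> measure lborel B / 2"
    "measure lborel ({x \<in> space lborel. f' x < m} \<inter> B) \<le> measure lborel B / 2"
    using exists_median[of f' lborel B] B by auto
  have pos: "(\<integral>\<^sup>+x. ennreal (max 0 (f' x - m) powr p) \<partial>restrict_space lborel \<Omega>) \<le> ennreal (X powr p)"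
    using m(1) X energy c
    by (intro john_truncated_Lp_bound[OF op f' p _ _ _ iso B]) auto
  have neg: "(\<integral>\<^sup>+x. ennreal (max 0 (- f' x - - m) powr p) \<partial>restrict_space lborel \<Omega>) \<le> ennreal (X powr p)"
    using m(2) X energy_neg c
    by (intro john_truncated_Lp_bound[OF op _ p _ _ _ iso B]) auto

  let ?M = "lebesgue_on \<Omega>"
  have "(\<integral>\<^sup>+x. ennreal (\<bar>f x - m\<bar> powr p) \<partial>?M) = (\<integral>\<^sup>+x. ennreal (\<bar>f x - m\<bar> powr p) * indicator \<Omega> x \<partial>lborel)"
    using op by (simp add: nn_integral_restrict_space nn_integral_completion)
  also have "\<dots> = (\<integral>\<^sup>+x. ennreal (\<bar>f' x - m\<bar> powr p) * indicator \<Omega> x \<partial>lborel)"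
    by (rule nn_integral_cong_AE, use ae in eventually_elim) (auto simp: indicator_def)
  also have "\<dots> = (\<integral>\<^sup>+x. ennreal (\<bar>f' x - m\<bar> powr p) \<partial>restrict_space lborel \<Omega>)"
    by (subst nn_integral_restrict_space) auto
  also have "\<dots> = (\<integral>\<^sup>+x. ennreal (max 0 (f' x - m) powr p) + ennreal (max 0 (- f' x - - m) powr p) \<partial>restrict_space lborel \<Omega>)"
    by (intro nn_integral_cong) (auto simp: max_def abs_if)
  also have "\<dots> = (\<integral>\<^sup>+x. ennreal (max 0 (f' x - m) powr p) \<partial>restrict_space lborel \<Omega>)
      + (\<integral>\<^sup>+x. ennreal (max 0 (- f' x - - m) powr p) \<partial>restrict_space lborel \<Omega>)"
    by (intro nn_integral_add measurable_restrict_space1) auto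
  also have "\<dots> \<le> ennreal (X powr p) + ennreal (X powr p)"
    by (intro add_mono pos neg)
  also have "\<dots> = ennreal (2 * X powr p)"
    by (simp flip: ennreal_plus)
  finally have J: "(\<integral>\<^sup>+x. ennreal (\<bar>f x - m\<bar> powr p) \<partial>?M) \<le> ennreal (2 * X powr p)" .

  let ?V = "measure ?M (space ?M)"
  have lm: "\<Omega> \<in> lmeasurable" using op by (intro lmeasurable_open) auto
  have fin: "finite_measure ?M" using lm by (rule finite_measure_lebesgue_on)
  then interpret finite_measure ?M .
  have V_eq: "?V = measure lebesgue \<Omega>"
    using op by (simp add: measure_restrict_space space_restrict_space)
  have V: "?V > 0"
  proof -
    have "\<not> negligible \<Omega>" using op ne by (simp add: open_not_negligible)
    then show ?thesis
      unfolding V_eq using lm by (simp add: negligible_iff_measure0 less_le)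
  qed
  define h where "h x = f x - m" for x
  have h: "integrable ?M h"
    unfolding h_def using f by (intro Bochner_Integration.integrable_diff) auto
  define a where "a = (LINT x|?M. h x) / ?V"
  have "(LINT x|?M. h x) = (LINT x|?M. f x) - m * ?V"
    unfolding h_def using f by (subst Bochner_Integration.integral_diff) auto
  then have mean: "mean_value \<Omega> f = m + a"
    using V unfolding mean_value_def a_def V_eq[symmetric] by (simp add: field_simps)
  have a: "?V * \<bar>a\<bar> powr p \<le> 2 * X powr p"
    unfolding a_def
  proof (rule nn_integral_powr_mean_le[OF fin h p _ _ V])
    show "(\<integral>\<^sup>+x. ennreal (\<bar>h x\<bar> powr p) \<partial>?M) \<le> ennreal (2 * X powr p)"
      using J by (simp add: h_def)
  qed simp
  have [measurable]: "h \<in> borel_measurable ?M" using h by simp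
  have "(\<integral>\<^sup>+x. ennreal (\<bar>f x - mean_value \<Omega> f\<bar> powr p) \<partial>?M)
      \<le> (\<integral>\<^sup>+x. ennreal (2 powr p) * (ennreal (\<bar>h x\<bar> powr p) + ennreal (\<bar>a\<bar> powr p)) \<partial>?M)"
  proof (intro nn_integral_mono)
    fix x
    have "\<bar>f x - mean_value \<Omega> f\<bar> powr p \<le> (\<bar>h x\<bar> + \<bar>a\<bar>) powr p"
      using p by (intro powr_mono2) (auto simp: mean h_def)
    also have "\<dots> \<le> 2 powr p * (\<bar>h x\<bar> powr p + \<bar>a\<bar> powr p)"
      using p by (intro powr_add_le) auto
    finally show "ennreal (\<bar>f x - mean_value \<Omega> f\<bar> powr p)
        \<le> ennreal (2 powr p) * (ennreal (\<bar>h x\<bar> powr p) + ennreal (\<bar>a\<bar> powr p))"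
      by (simp add: ennreal_leI flip: ennreal_mult ennreal_plus)
  qed
  also have "\<dots> = ennreal (2 powr p) * ((\<integral>\<^sup>+x. ennreal (\<bar>h x\<bar> powr p) \<partial>?M) + ennreal (\<bar>a\<bar> powr p) * ennreal ?V)"
    by (simp add: nn_integral_cmult nn_integral_add emeasure_eq_measure)
  also have "\<dots> \<le> ennreal (2 powr p) * (ennreal (2 * X powr p) + ennreal (2 * X powr p))"
    using J a by (intro mult_left_mono add_mono) (auto simp: h_def mult.commute ennreal_leI simp flip: ennreal_mult)
  also have "\<dots> = ennreal (2 powr p * 4 * X powr p)"
    by (simp flip: ennreal_mult ennreal_plus)
  also have "\<dots> \<le> ennreal ((8 * X) powr p)"
  proof (intro ennreal_leI)
    have "4 powr 1 \<le> (4::real) powr p" using p by (intro powr_mono) auto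
    then have "2 powr p * 4 \<le> 2 powr p * (4::real) powr p" by simp
    also have "\<dots> = 8 powr p" by (simp flip: powr_mult)
    finally show "2 powr p * 4 * X powr p \<le> (8 * X) powr p"
      using X(2) by (simp add: powr_mult mult_right_mono)
  qed
  finally have "Lp_norm p \<Omega> (\<lambda>x. f x - mean_value \<Omega> f) \<le> ennreal (8 * X)"
    using X p by (intro Lp_norm_le) auto
  also have "\<dots> = ennreal (8 * C * (1 - \<delta>)) * fractional_energy \<tau> \<delta> \<Omega> f"
  proof -
    have "ennreal (8 * X) = ennreal 8 * ennreal X" by (rule ennreal_mult) (use X in auto)
    also have "\<dots> = ennreal (8 * c) * fractional_energy \<tau> \<delta> \<Omega> f"
      unfolding X(1) using c by (subst ennreal_mult_assoc) auto
    finally show ?thesis by (simp add: c_def mult.assoc)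
  qed
  finally show ?thesis .
qed

theorem corollary1p7:
  fixes s \<tau> CJ D :: real
  assumes "CARD('n::finite) \<ge> 2" and "0 < \<tau>" and "\<tau> < 1" and "1 \<le> s" and "CJ \<ge> 1"
  shows "\<exists>C>0. \<forall>\<delta> (\<Omega> :: (real ^ 'n) set) xJ.
           0 < \<delta> \<longrightarrow> \<delta> < 1 \<longrightarrow> s \<le> real CARD('n) / (real CARD('n) - \<delta>) \<longrightarrow>
           distance_john_domain s CJ xJ \<Omega> \<longrightarrow> diameter \<Omega> = D \<longrightarrow>
           (\<forall>f. integrable (lebesgue_on \<Omega>) f \<longrightarrow>
              Lp_norm (real CARD('n) / (s * (real CARD('n) - \<delta>))) \<Omega> (\<lambda>x. f x - mean_value \<Omega> f)
              \<le> ennreal (C * (1 - \<delta>)) * fractional_energy \<tau> \<delta> \<Omega> f)"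
proof -
  define n where "n = CARD('n)"
  have n: "DIM(real ^ 'n) = n" by (simp add: n_def)
  define C where "C = max 1 (unit_ball_vol n * (5 * ((3 * CJ / \<tau>) powr (1 / s) + 1 + D)) ^ n) *
        (2 ^ (n + 5) / (unit_ball_vol n)\<^sup>2)"
  have "8 * C > 0"
    unfolding C_def
    by (intro mult_pos_pos divide_pos_pos zero_less_power) (auto simp: less_max_iff_disj)
  moreover have "Lp_norm (real n / (s * (real n - \<delta>))) \<Omega> (\<lambda>x. f x - mean_value \<Omega> f)
      \<le> ennreal (8 * C * (1 - \<delta>)) * fractional_energy \<tau> \<delta> \<Omega> f"
    if "0 < \<delta>" "\<delta> < 1" "s \<le> real n / (real n - \<delta>)" "distance_john_domain s CJ xJ \<Omega>"
      "diameter \<Omega> = D" "integrable (lebesgue_on \<Omega>) f"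
    for \<delta> xJ f and \<Omega> :: "(real ^ 'n) set"
    using john_fractional_sobolev_poincare[OF assms(2,3) that(1,2) _ that(4,6)] that(3,5)
    unfolding C_def n by simp
  ultimately show ?thesis
    unfolding n_def[symmetric] by (intro exI[of _ "8 * C"]) blast
qed

end
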